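(* Let $X\subset\mathbb{P}^n$ be a subscheme. Let $\alpha:=\alpha(I_X)$ be the least degree $t$ such that $[I_X]_t\neq0$. If $AV_{X,0}(\alpha)=0$, then $X$ does not admit unexpected hypersurfaces, for any degree and any multiplicity at a general point.
   Context: $K$ is an infinite field and $R=K[x_0,\dots,x_n]$. For a closed subscheme $X\subset\mathbb{P}^n$, $I_X\subseteq R$ is its saturated homogeneous ideal; $[\,\cdot\,]_t$ is the degree $t$ component. It is understood that $X$ is nonempty and $I_X\ne 0$, so that $\alpha$ is defined and $\alpha\ge1$. Let $P\in\mathbb{P}^n$ be a general point (i.e. in a suitable nonempty Zariski open subset) with ideal $I_P$. Set $\operatorname{adim}(X,t,m)=\dim[I_X\cap I_P^m]_t$, $\operatorname{vdim}(X,t,m)=\dim[I_X]_t-\binom{m+n-1}{n}$, $\operatorname{edim}(X,t,m)=\max\{0,\operatorname{vdim}(X,t,m)\}$. For $j\ge0$, $m\ge1$, $AV_{X,j}(m)=\operatorname{adim}(X,m+j,m)-\operatorname{vdim}(X,m+j,m)$. $X$ admits an unexpected hypersurface of degree $t$ for multiplicity $m$ ($t,m\ge1$) if $\operatorname{adim}(X,t,m)>\operatorname{edim}(X,t,m)$. *)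

theory Defs
  imports Complex_Main "HOL-Library.Cardinality" "HOL-Library.Poly_Mapping"
begin

text \<open>The ring \<open>R = K[x\<^sub>0, \<dots>, x\<^sub>n]\<close>. The variables are the elements of a finite type
  \<open>'v\<close> with \<open>n + 1\<close> elements.\<close>

type_synonym ('v, 'a) mpoly = "('v \<Rightarrow>\<^sub>0 nat) \<Rightarrow>\<^sub>0 'a"

definition Var :: "'v \<Rightarrow> ('v, 'a::field) mpoly" where
  "Var i = Poly_Mapping.single (Poly_Mapping.single i 1) 1"

definition scal :: "'a::field \<Rightarrow> ('v, 'a) mpoly \<Rightarrow> ('v, 'a) mpoly" where
  "scal c p = Poly_Mapping.single 0 c * p"

lemma vector_space_scal: "vector_space (scal :: 'a::field \<Rightarrow> ('v, 'a) mpoly \<Rightarrow> _)"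
  by unfold_locales
    (simp_all add: scal_def algebra_simps single_add mult_single flip: mult.assoc)

abbreviation Kdim :: "('v, 'a::field) mpoly set \<Rightarrow> nat" where
  "Kdim \<equiv> vector_space.dim scal"

definition eval :: "('v::finite, 'a::field) mpoly \<Rightarrow> ('v \<Rightarrow> 'a) \<Rightarrow> 'a" where
  "eval p P = (\<Sum>u\<in>Poly_Mapping.keys p. Poly_Mapping.lookup p u * (\<Prod>i\<in>UNIV. P i ^ Poly_Mapping.lookup u i))"

text \<open>\<open>forms t\<close> is \<open>[R]\<^sub>t\<close>; it contains \<open>0\<close>.\<close>

definition forms :: "nat \<Rightarrow> ('v::finite, 'a::field) mpoly set" where
  "forms t = {p. \<forall>u\<in>Poly_Mapping.keys p. (\<Sum>i\<in>UNIV. Poly_Mapping.lookup u i) = t}"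

definition degree_part :: "('v::finite, 'a::field) mpoly set \<Rightarrow> nat \<Rightarrow> ('v, 'a) mpoly set" where
  "degree_part I t = I \<inter> forms t"

text \<open>Ideals are the submodules of the ring regarded as a module over itself.\<close>

lemma module_mult: "module ((*) :: 'b::comm_ring_1 \<Rightarrow> 'b \<Rightarrow> 'b)"
  by unfold_locales (simp_all add: algebra_simps)

abbreviation is_ideal :: "'b::comm_ring_1 set \<Rightarrow> bool" where
  "is_ideal \<equiv> module.subspace (*)"

abbreviation ideal_gen :: "'b::comm_ring_1 set \<Rightarrow> 'b set" where
  "ideal_gen \<equiv> module.span (*)"

fun ideal_pow :: "'b::comm_ring_1 set \<Rightarrow> nat \<Rightarrow> 'b set" where
  "ideal_pow J 0 = UNIV"
| "ideal_pow J (Suc m) = ideal_gen {a * b | a b. a \<in> J \<and> b \<in> ideal_pow J m}"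

definition homogeneous_ideal :: "('v::finite, 'a::field) mpoly set \<Rightarrow> bool" where
  "homogeneous_ideal I \<longleftrightarrow> (\<exists>S. S \<subseteq> (\<Union>t. forms t) \<and> I = ideal_gen S)"

definition saturated :: "('v::finite, 'a::field) mpoly set \<Rightarrow> bool" where
  "saturated I \<longleftrightarrow>
     (\<forall>p. (\<exists>k. \<forall>q\<in>ideal_pow (ideal_gen (range Var)) k. q * p \<in> I) \<longrightarrow> p \<in> I)"

text \<open>A closed subscheme \<open>X\<close> of \<open>\<P>\<^sup>n\<close> over \<open>K\<close> is represented by its ideal \<open>I\<^sub>X\<close>: the map
  \<open>X \<mapsto> I\<^sub>X\<close> is a bijection onto the saturated homogeneous ideals of \<open>R\<close>, and \<open>X\<close> is empty
  iff \<open>I\<^sub>X = R\<close>.\<close>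

definition subscheme_ideal :: "('v::finite, 'a::field) mpoly set \<Rightarrow> bool" where
  "subscheme_ideal I \<longleftrightarrow> is_ideal I \<and> homogeneous_ideal I \<and> saturated I"

text \<open>A point of \<open>\<P>\<^sup>n(K)\<close> is given by a nonzero vector \<open>P\<close> of homogeneous coordinates. The ideal
  below and the open sets further down are unchanged when \<open>P\<close> is rescaled, because only
  homogeneous polynomials are evaluated.\<close>

definition point_ideal :: "('v::finite \<Rightarrow> 'a::field) \<Rightarrow> ('v, 'a) mpoly set" where
  "point_ideal P = ideal_gen {f. (\<exists>t. f \<in> forms t) \<and> eval f P = 0}"

text \<open>An open set is the complement of the common zero locus of a set \<open>S\<close> of forms.\<close>

definition zariski_open :: "('v::finite \<Rightarrow> 'a::field) set \<Rightarrow> bool" where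
  "zariski_open U \<longleftrightarrow>
     (\<exists>S. S \<subseteq> (\<Union>t. forms t) \<and> U = {P. P \<noteq> (\<lambda>_. 0) \<and> (\<exists>f\<in>S. eval f P \<noteq> 0)})"

definition general_point :: "(('v::finite \<Rightarrow> 'a::field) \<Rightarrow> bool) \<Rightarrow> bool" where
  "general_point Q \<longleftrightarrow> (\<exists>U. zariski_open U \<and> U \<noteq> {} \<and> (\<forall>P\<in>U. Q P))"

text \<open>The dimension of \<open>[I \<inter> I\<^sub>P\<^sup>m]\<^sub>t\<close> at a general point \<open>P\<close>. Over an infinite field this value
  exists, since the dimension is upper semicontinuous in \<open>P\<close>, and it is unique, since any two
  nonempty open sets of \<open>\<P>\<^sup>n(K)\<close> meet.\<close>

definition adim :: "('v::finite, 'a::field) mpoly set \<Rightarrow> nat \<Rightarrow> nat \<Rightarrow> nat" where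
  "adim I t m = (THE d. general_point
     (\<lambda>P. Kdim (degree_part (I \<inter> ideal_pow (point_ideal P) m) t) = d))"

definition vdim :: "('v::finite, 'a::field) mpoly set \<Rightarrow> nat \<Rightarrow> nat \<Rightarrow> int" where
  "vdim I t m = (let n = CARD('v) - 1 in
     int (Kdim (degree_part I t)) - int ((m + n - 1) choose n))"

definition edim :: "('v::finite, 'a::field) mpoly set \<Rightarrow> nat \<Rightarrow> nat \<Rightarrow> int" where
  "edim I t m = max 0 (vdim I t m)"

definition AV :: "('v::finite, 'a::field) mpoly set \<Rightarrow> nat \<Rightarrow> nat \<Rightarrow> int" where
  "AV I j m = int (adim I (m + j) m) - vdim I (m + j) m"

definition admits_unexpected :: "('v::finite, 'a::field) mpoly set \<Rightarrow> nat \<Rightarrow> nat \<Rightarrow> bool" where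
  "admits_unexpected I t m \<longleftrightarrow> int (adim I t m) > edim I t m"

definition alpha :: "('v::finite, 'a::field) mpoly set \<Rightarrow> nat" where
  "alpha I = (LEAST t. degree_part I t \<noteq> {0})"

end

theory Submission
  imports Defs "HOL-Library.Multiset" "HOL-Computational_Algebra.Polynomial"
begin

text \<open>
  Write \<open>I\<close> for the ideal, \<open>\<alpha>\<close> for its initial degree, \<open>I\<^sub>P\<close> for the ideal of a point \<open>P\<close> and
  \<open>[J]\<^sub>t\<close> for the forms of degree \<open>t\<close> in \<open>J\<close>.

  For \<open>1 \<le> m \<le> t\<close> the space \<open>[I\<^sub>P\<^sup>m]\<^sub>t\<close> has codimension \<open>(m + n - 1) choose n\<close> in the space of all
  forms of degree \<open>t\<close> (\<open>codim_ideal_pow_point\<close>). The dimension formula for a sum of two subspaces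
  therefore shows that \<open>[I \<inter> I\<^sub>P\<^sup>m]\<^sub>t\<close> has the virtual dimension if and only if
  \<open>[I]\<^sub>t + [I\<^sub>P\<^sup>m]\<^sub>t\<close> consists of all forms of degree \<open>t\<close> (\<open>dim_eq_vdim_iff\<close>). So the hypothesis on
  \<open>AV\<close> says that \<open>[I]\<^sub>\<alpha> + [I\<^sub>P\<^sup>\<alpha>]\<^sub>\<alpha>\<close> is everything for a general point \<open>P\<close>.

  Choose linear coordinates in which \<open>P = (1, 0, \<dots>, 0)\<close>. Then \<open>[I\<^sub>P\<^sup>t]\<^sub>t\<close> consists of the forms
  without \<open>x\<^sub>0\<close>, and the hypothesis says that modulo \<open>I\<close> every form of degree \<open>\<alpha>\<close> is congruent to one
  without \<open>x\<^sub>0\<close>. This property passes from degree \<open>t\<close> to degree \<open>t + 1\<close>: given a monomial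
  \<open>x\<^sub>j w\<close> with \<open>j \<noteq> 0\<close>, replace \<open>w\<close> by a form without \<open>x\<^sub>0\<close>; given the monomial \<open>x\<^sub>0\<^sup>t\<^sup>+\<^sup>1\<close>, replace
  one factor \<open>x\<^sub>0\<^sup>t\<close> by a form without \<open>x\<^sub>0\<close>, which reduces it to monomials of the first kind because
  \<open>t \<ge> 1\<close> (\<open>vanishing_complement_propagates\<close>). Hence \<open>[I]\<^sub>t + [I\<^sub>P\<^sup>t]\<^sub>t\<close> is everything for all
  \<open>t \<ge> \<alpha>\<close>, and so is the larger space \<open>[I]\<^sub>t + [I\<^sub>P\<^sup>m]\<^sub>t\<close> for \<open>m \<le> t\<close>. In this range the general
  dimension is thus the virtual one. If \<open>t < \<alpha>\<close> or \<open>m > t\<close>, then \<open>[I \<inter> I\<^sub>P\<^sup>m]\<^sub>t = 0\<close>.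

  Since \<open>adim\<close> is defined by a definite description, the hypothesis can be used only once the
  general dimension is known to exist (\<open>general_dim_exists\<close>), and the conclusion needs its
  uniqueness (\<open>adim_eqI\<close>). Existence is semicontinuity: a complement of \<open>[I \<inter> I\<^sub>P\<^sup>m]\<^sub>t\<close> in \<open>[I]\<^sub>t\<close> at a
  point where the dimension is minimal still meets this space trivially at all points of an
  open neighbourhood, because linear independence of vectors whose entries are forms in \<open>P\<close> is an open condition
  (\<open>independence_is_open\<close>).
\<close>

section \<open>Finitely spanned subspaces\<close>

text \<open>The ambient space will be the polynomial ring, which has infinite dimension. Finiteness enters
  through a finite set \<open>E\<close> whose span contains the subspaces under consideration.\<close>

context vector_space
begin

lemma finite_basis_of_subspace:
  assumes "subspace V" "V \<subseteq> span E" "finite E" "A \<subseteq> V" "independent A"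
  obtains B where "A \<subseteq> B" "B \<subseteq> V" "independent B" "span B = V" "finite B" "card B = dim V"
proof -
  obtain B where B: "A \<subseteq> B" "B \<subseteq> V" "independent B" "V \<subseteq> span B"
    using maximal_independent_subset_extend[OF assms(4,5)] by blast
  have "finite B"
    using independent_span_bound[OF assms(3) B(3)] B(2) assms(2) by blast
  moreover have "span B = V"
    using span_subspace[OF B(2,4) assms(1)] .
  ultimately show thesis
    using that B basis_card_eq_dim[OF B(2,4,3)] by blast
qed

lemma exists_finite_basis:
  assumes "subspace V" "V \<subseteq> span E" "finite E"
  obtains B where "B \<subseteq> V" "independent B" "span B = V" "finite B" "card B = dim V"
  by (rule finite_basis_of_subspace[OF assms empty_subsetI independent_empty])

lemma dim_subspace_mono:
  assumes "subspace V" "V \<subseteq> span E" "finite E" "subspace N" "N \<subseteq> V"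
  shows "dim N \<le> dim V"
proof -
  obtain A where A: "A \<subseteq> N" "independent A" "span A = N" "finite A" "card A = dim N"
    by (rule exists_finite_basis[OF assms(4) subset_trans[OF assms(5,2)] assms(3)])
  obtain B where B: "A \<subseteq> B" "B \<subseteq> V" "independent B" "span B = V" "finite B" "card B = dim V"
    by (rule finite_basis_of_subspace[OF assms(1-3) subset_trans[OF A(1) assms(5)] A(2)])
  show ?thesis using card_mono[OF B(5,1)] A(5) B(6) by simp
qed

lemma subspace_eq_of_dim:
  assumes "subspace V" "V \<subseteq> span E" "finite E" "subspace N" "N \<subseteq> V" "dim V \<le> dim N"
  shows "N = V"
proof -
  obtain A where A: "A \<subseteq> N" "independent A" "span A = N" "finite A" "card A = dim N"
    by (rule exists_finite_basis[OF assms(4) subset_trans[OF assms(5,2)] assms(3)])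
  obtain B where B: "A \<subseteq> B" "B \<subseteq> V" "independent B" "span B = V" "finite B" "card B = dim V"
    by (rule finite_basis_of_subspace[OF assms(1-3) subset_trans[OF A(1) assms(5)] A(2)])
  have "A = B" using card_seteq[OF B(5,1)] A(5) B(6) assms(6) by simp
  then show ?thesis using A(3) B(4) by simp
qed

lemma dim_sum_add_dim_Int:
  assumes V: "subspace V" "V \<subseteq> span E" and W: "subspace W" "W \<subseteq> span E" and E: "finite E"
  shows "dim {x + y | x y. x \<in> V \<and> y \<in> W} + dim (V \<inter> W) = dim V + dim W"
proof -
  have VW: "V \<inter> W \<subseteq> span E" using V(2) by blast
  obtain A where A: "A \<subseteq> V \<inter> W" "independent A" "span A = V \<inter> W" "finite A" "card A = dim (V \<inter> W)"
    by (rule exists_finite_basis[OF subspace_inter[OF V(1) W(1)] VW E])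
  have AV: "A \<subseteq> V" and AW: "A \<subseteq> W" using A(1) by auto
  obtain B where B: "A \<subseteq> B" "B \<subseteq> V" "independent B" "span B = V" "finite B" "card B = dim V"
    by (rule finite_basis_of_subspace[OF V E AV A(2)])
  obtain C where C: "A \<subseteq> C" "C \<subseteq> W" "independent C" "span C = W" "finite C" "card C = dim W"
    by (rule finite_basis_of_subspace[OF W E AW A(2)])
  \<comment> \<open>The basis \<open>B\<close> of \<open>V\<close> remains independent when vectors of \<open>C - A\<close> are added one at a
    time: if \<open>c\<close> depended on \<open>B \<union> X\<close>, then modulo \<open>span X\<close> it would lie in \<open>V \<inter> W = span A\<close>, against
    the independence of \<open>C\<close>.\<close>
  have indep: "B \<inter> X = {} \<and> independent (B \<union> X)" if "finite X" "X \<subseteq> C - A" for X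
    using that
  proof (induction X)
    case empty
    then show ?case using B by simp
  next
    case (insert c X)
    have "c \<notin> span (B \<union> X)"
    proof
      assume "c \<in> span (B \<union> X)"
      then obtain b x where bx: "c = b + x" "b \<in> V" "x \<in> span X"
        using B(4) by (auto simp: span_Un)
      have "x \<in> span C" "c \<in> span C"
        using bx insert.prems span_mono[of X C] by (auto intro: span_base)
      then have "c - x \<in> W"
        using span_diff C(4) by blast
      then have "b \<in> span A"
        using bx A(3) by (simp add: algebra_simps)
      then have "c \<in> span (A \<union> X)"
        using bx by (auto simp: span_Un)
      moreover have "A \<union> X \<subseteq> C - {c}"
        using insert C(1) by auto
      ultimately show False
        using C(3) span_mono insert.prems unfolding dependent_def by blast
    qed
    moreover from this have "c \<notin> B" by (auto intro: span_base)
    ultimately show ?case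
      using insert by (auto simp: independent_insertI)
  qed
  have BC: "B \<inter> (C - A) = {}" "independent (B \<union> (C - A))"
    using indep[of "C - A"] C(5) by auto
  have "B \<union> C = B \<union> (C - A)" using B(1) by auto
  then have "card (B \<union> (C - A)) = dim (span (B \<union> C))"
    using dim_span_eq_card_independent[OF BC(2)] by simp
  also have "span (B \<union> C) = {x + y | x y. x \<in> V \<and> y \<in> W}"
    by (simp add: span_Un B(4) C(4))
  finally have "dim {x + y | x y. x \<in> V \<and> y \<in> W} = card B + card (C - A)"
    using BC(1) B(5) C(5) by (simp add: card_Un_disjoint)
  moreover have "card (C - A) + card A = card C"
    using card_Diff_subset[OF A(4) C(1)] card_mono[OF C(5,1)] by simp
  ultimately show ?thesis
    using A(5) B(6) C(6) by linarith
qed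

lemma dim_eq_0_of_finitely_spanned:
  assumes "subspace V" "V \<subseteq> span E" "finite E" "dim V = 0"
  shows "V = {0}"
proof -
  obtain B where B: "B \<subseteq> V" "independent B" "span B = V" "finite B" "card B = dim V"
    by (rule exists_finite_basis[OF assms(1-3)])
  have "B = {}" using B(4,5) assms(4) by simp
  then show ?thesis using B(3) by simp
qed

text \<open>A basis of a complement of \<open>N\<close> in \<open>V\<close>.\<close>

lemma complement_basis:
  assumes V: "subspace V" "V \<subseteq> span E" "finite E" and N: "subspace N" "N \<subseteq> V"
  obtains C where "finite C" "independent C" "C \<subseteq> V" "card C + dim N = dim V"
    "span C \<inter> N = {0}"
proof -
  have NE: "N \<subseteq> span E" using N(2) V(2) by blast
  obtain A where A: "A \<subseteq> N" "independent A" "span A = N" "finite A" "card A = dim N"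
    by (rule exists_finite_basis[OF N(1) NE V(3)])
  have AV: "A \<subseteq> V" using A(1) N(2) by blast
  obtain B where B: "A \<subseteq> B" "B \<subseteq> V" "independent B" "span B = V" "finite B" "card B = dim V"
    by (rule finite_basis_of_subspace[OF V AV A(2)])
  define C where "C = B - A"
  have ind: "independent C" using B(3) C_def independent_mono by blast
  have card: "card C + dim N = dim V"
    using card_Diff_subset[OF A(4) B(1)] card_mono[OF B(5,1)] A(5) B(6) by (simp add: C_def)
  have CE: "span C \<subseteq> span E"
    using B(4) V(2) C_def span_mono[of C B] by auto
  have "{x + y | x y. x \<in> span C \<and> y \<in> N} = span (C \<union> A)"
    by (simp add: span_Un A(3))
  also have "C \<union> A = B" using B(1) C_def by auto
  finally have "dim V + dim (span C \<inter> N) = dim (span C) + dim N"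
    using dim_sum_add_dim_Int[of "span C" E N] CE N(1) NE V(3) B(4) by simp
  then have "dim (span C \<inter> N) = 0"
    using card dim_span_eq_card_independent[OF ind] by linarith
  then have "span C \<inter> N = {0}"
    using dim_eq_0_of_finitely_spanned[of "span C \<inter> N" E] CE N(1) V(3) subspace_inter subspace_span
    by blast
  then show thesis
    using that[of C] ind card B(2,5) C_def by blast
qed

lemma dim_le_of_trivial_Int:
  assumes V: "subspace V" "V \<subseteq> span E" "finite E" and N: "subspace N" "N \<subseteq> V"
    and C: "independent C" "C \<subseteq> V" "span C \<inter> N = {0}"
  shows "card C + dim N \<le> dim V"
proof -
  let ?S = "{x + y | x y. x \<in> span C \<and> y \<in> N}"
  have CV: "span C \<subseteq> V" using C(2) V(1) by (rule span_minimal)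
  have "?S \<subseteq> V"
    using CV N(2) V(1) by (auto intro!: subspace_add)
  then have "dim ?S \<le> dim V"
    using dim_subspace_mono[OF V] subspace_sums N(1) subspace_span by blast
  moreover have "dim ?S + dim (span C \<inter> N) = card C + dim N"
    using dim_sum_add_dim_Int[of "span C" E N] CV N V dim_span_eq_card_independent[OF C(1)] by auto
  moreover have "dim (span C \<inter> N) = 0"
    using C(3) dim_span_eq_card_independent[OF independent_empty] by simp
  ultimately show ?thesis by linarith
qed

end

section \<open>Polynomials, degrees and substitution\<close>

interpretation ideals: module "(*) :: 'b::comm_ring_1 \<Rightarrow> 'b \<Rightarrow> 'b"
  by (rule module_mult)

interpretation K: vector_space "scal :: 'a::field \<Rightarrow> ('v, 'a) mpoly \<Rightarrow> ('v, 'a) mpoly"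
  by (rule vector_space_scal)

text \<open>The degree of the monomial with exponent \<open>u\<close> in the variables from \<open>A\<close>.\<close>

definition wt :: "'v set \<Rightarrow> ('v::finite \<Rightarrow>\<^sub>0 nat) \<Rightarrow> nat" where
  "wt A u = (\<Sum>i\<in>A. Poly_Mapping.lookup u i)"

lemma wt_add: "wt A (u + v) = wt A u + wt A v"
  by (simp add: wt_def lookup_add sum.distrib)

lemma wt_zero [simp]: "wt A 0 = 0"
  by (simp add: wt_def)

lemma wt_single [simp]: "wt A (Poly_Mapping.single i k) = (if i \<in> A then k else 0)"
  by (simp add: wt_def lookup_single when_def)

lemma wt_UNIV_eq: "wt UNIV u = Poly_Mapping.lookup u i + wt (- {i}) u"
  unfolding wt_def Compl_eq_Diff_UNIV by (rule sum.remove) simp_all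

lemma lookup_pos_split:
  fixes u :: "'v \<Rightarrow>\<^sub>0 nat"
  assumes "Poly_Mapping.lookup u i > 0"
  obtains v where "u = Poly_Mapping.single i 1 + v"
proof -
  have "u = Poly_Mapping.single i 1 + (u - Poly_Mapping.single i 1)"
    using assms by (intro poly_mapping_eqI) (auto simp: lookup_add lookup_minus lookup_single when_def)
  then show thesis by (rule that)
qed

lemma wt_pos_split:
  assumes "wt A u > 0"
  obtains i v where "i \<in> A" "u = Poly_Mapping.single i 1 + v"
proof -
  obtain i where "i \<in> A" "Poly_Mapping.lookup u i > 0"
    using assms unfolding wt_def by (metis gr0I less_numeral_extra(3) sum.neutral)
  then show thesis using that lookup_pos_split by metis
qed

lemma mpoly_expand:
  "p = (\<Sum>u\<in>Poly_Mapping.keys p. Poly_Mapping.single u (Poly_Mapping.lookup p u))"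
proof (rule poly_mapping_eqI)
  fix k
  have "(\<Sum>u\<in>Poly_Mapping.keys p. Poly_Mapping.lookup (Poly_Mapping.single u (Poly_Mapping.lookup p u)) k)
      = (\<Sum>u\<in>Poly_Mapping.keys p. if u = k then Poly_Mapping.lookup p u else 0)"
    by (intro sum.cong) (auto simp: lookup_single when_def)
  also have "\<dots> = Poly_Mapping.lookup p k"
    by (simp add: in_keys_iff)
  finally show "Poly_Mapping.lookup p k = Poly_Mapping.lookup
      (\<Sum>u\<in>Poly_Mapping.keys p. Poly_Mapping.single u (Poly_Mapping.lookup p u)) k"
    by (simp add: lookup_sum)
qed

lemma lookup_scal: "Poly_Mapping.lookup (scal c p) u = c * Poly_Mapping.lookup p u"
proof -
  have "scal c p = Poly_Mapping.map ((*) c) p"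
    by (simp add: scal_def mult_map_scale_conv_mult)
  then show ?thesis by (simp add: Poly_Mapping.map.rep_eq when_def)
qed

lemma keys_scal: "Poly_Mapping.keys (scal c p) \<subseteq> Poly_Mapping.keys p"
  by (auto simp: in_keys_iff lookup_scal)

lemma ideal_mult_left: "is_ideal I \<Longrightarrow> x \<in> I \<Longrightarrow> (c::'b::comm_ring_1) * x \<in> I"
  by (rule ideals.subspace_scale)

lemma subspace_ideal: "is_ideal I \<Longrightarrow> K.subspace I"
  unfolding K.subspace_def scal_def
  by (simp add: ideals.subspace_0 ideals.subspace_add ideals.subspace_scale)

lemma single_eq_scal: "Poly_Mapping.single u c = scal c (Poly_Mapping.single u 1)"
  by (simp add: scal_def mult_single)

subsection \<open>Ring homomorphisms\<close>

text \<open>Unital homomorphisms between commutative rings that are types.\<close>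

definition ring_map :: "('b::comm_ring_1 \<Rightarrow> 'c::comm_ring_1) \<Rightarrow> bool" where
  "ring_map f \<longleftrightarrow> f 0 = 0 \<and> f 1 = 1 \<and> (\<forall>x y. f (x + y) = f x + f y) \<and> (\<forall>x y. f (x * y) = f x * f y)"

lemma ring_mapD:
  assumes "ring_map f"
  shows "f 0 = 0" "f 1 = 1" "f (x + y) = f x + f y" "f (x * y) = f x * f y"
  using assms by (auto simp: ring_map_def)

lemma ring_map_sum:
  assumes "ring_map f" shows "f (sum g A) = (\<Sum>x\<in>A. f (g x))"
  by (induction A rule: infinite_finite_induct) (simp_all add: ring_mapD[OF assms])

lemma ring_map_power:
  assumes "ring_map f" shows "f (x ^ n) = f x ^ n"
  by (induction n) (simp_all add: ring_mapD[OF assms])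

lemma ring_map_prod:
  assumes "ring_map f" shows "f (prod g A) = (\<Prod>x\<in>A. f (g x))"
  by (induction A rule: infinite_finite_induct) (simp_all add: ring_mapD[OF assms])

lemma ring_map_diff:
  assumes "ring_map f" shows "f (x - y) = f x - f y"
  using ring_mapD(3)[OF assms, of "x - y" y] by simp

lemma ring_map_ident: "ring_map (\<lambda>x. x)"
  by (simp add: ring_map_def)

lemma ring_map_const: "ring_map (Poly_Mapping.single 0 :: 'a::field \<Rightarrow> ('v, 'a) mpoly)"
  by (simp add: ring_map_def single_add mult_single)

text \<open>The homomorphism out of the polynomial ring that is \<open>h\<close> on constants and sends the
  variable \<open>i\<close> to \<open>g i\<close>. Evaluation at a point, linear substitution and restriction to a line
  are instances.\<close>

definition hom_ext ::
    "('a::field \<Rightarrow> 'b::comm_ring_1) \<Rightarrow> ('v::finite \<Rightarrow> 'b) \<Rightarrow> ('v, 'a) mpoly \<Rightarrow> 'b" where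
  "hom_ext h g p = (\<Sum>u\<in>Poly_Mapping.keys p. h (Poly_Mapping.lookup p u) *
     (\<Prod>i\<in>UNIV. g i ^ Poly_Mapping.lookup u i))"

lemma hom_ext_superset:
  assumes "ring_map h" "finite A" "Poly_Mapping.keys p \<subseteq> A"
  shows "hom_ext h g p = (\<Sum>u\<in>A. h (Poly_Mapping.lookup p u) *
     (\<Prod>i\<in>UNIV. g i ^ Poly_Mapping.lookup u i))"
  unfolding hom_ext_def using assms(2,3)
  by (intro sum.mono_neutral_left) (auto simp: in_keys_iff ring_mapD[OF assms(1)])

lemma hom_ext_add:
  assumes "ring_map h"
  shows "hom_ext h g (p + q) = hom_ext h g p + hom_ext h g q"
proof -
  let ?A = "Poly_Mapping.keys p \<union> Poly_Mapping.keys q"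
  have "Poly_Mapping.keys (p + q) \<subseteq> ?A" by (rule keys_add)
  then show ?thesis
    using hom_ext_superset[OF assms, of ?A]
    by (simp add: lookup_add ring_mapD[OF assms] distrib_right sum.distrib)
qed

lemma hom_ext_zero [simp]: "hom_ext h g 0 = 0"
  by (simp add: hom_ext_def)

lemma hom_ext_sum:
  "ring_map h \<Longrightarrow> hom_ext h g (sum f A) = (\<Sum>x\<in>A. hom_ext h g (f x))"
  by (induction A rule: infinite_finite_induct) (simp_all add: hom_ext_add)

lemma hom_ext_single:
  assumes "ring_map h"
  shows "hom_ext h g (Poly_Mapping.single u c) = h c * (\<Prod>i\<in>UNIV. g i ^ Poly_Mapping.lookup u i)"
  using hom_ext_superset[OF assms, of "{u}" "Poly_Mapping.single u c"] by simp

lemma hom_ext_Var: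
  assumes "ring_map h"
  shows "hom_ext h g (Var i) = g i"
proof -
  have "(\<Prod>j\<in>UNIV. g j ^ (1 when i = j)) = (\<Prod>j\<in>UNIV. if i = j then g j else 1)"
    by (intro prod.cong) (auto simp: when_def)
  then show ?thesis
    by (simp add: Var_def hom_ext_single[OF assms] ring_mapD[OF assms] lookup_single)
qed

lemma hom_ext_mult:
  assumes "ring_map h"
  shows "hom_ext h g (p * q) = hom_ext h g p * hom_ext h g q"
proof -
  have single: "hom_ext h g (Poly_Mapping.single u c * Poly_Mapping.single v d) =
      hom_ext h g (Poly_Mapping.single u c) * hom_ext h g (Poly_Mapping.single v d)" for u v c d
    unfolding mult_single hom_ext_single[OF assms] ring_mapD(4)[OF assms] lookup_add power_add
      prod.distrib by (simp only: mult_ac)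
  have "p * q = (\<Sum>u\<in>Poly_Mapping.keys p. \<Sum>v\<in>Poly_Mapping.keys q.
      Poly_Mapping.single u (Poly_Mapping.lookup p u) * Poly_Mapping.single v (Poly_Mapping.lookup q v))"
    unfolding sum_product[symmetric] mpoly_expand[symmetric] ..
  then have "hom_ext h g (p * q) =
      (\<Sum>u\<in>Poly_Mapping.keys p. hom_ext h g (Poly_Mapping.single u (Poly_Mapping.lookup p u))) *
      (\<Sum>v\<in>Poly_Mapping.keys q. hom_ext h g (Poly_Mapping.single v (Poly_Mapping.lookup q v)))"
    by (simp only: hom_ext_sum[OF assms] single sum_product)
  then show ?thesis
    by (simp only: hom_ext_sum[OF assms, symmetric] mpoly_expand[symmetric])
qed

lemma ring_map_hom_ext:
  assumes "ring_map h"
  shows "ring_map (hom_ext h g)"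
proof -
  have "hom_ext h g 1 = 1"
    using hom_ext_single[OF assms, of g 0 1] ring_mapD(2)[OF assms] by simp
  then show ?thesis
    by (simp add: ring_map_def[of "hom_ext h g"] hom_ext_add[OF assms] hom_ext_mult[OF assms])
qed

lemma ring_map_comp_hom_ext:
  assumes "ring_map f"
  shows "f (hom_ext h g p) = hom_ext (\<lambda>c. f (h c)) (\<lambda>i. f (g i)) p"
  by (simp add: hom_ext_def ring_map_sum[OF assms] ring_map_prod[OF assms] ring_map_power[OF assms]
      ring_mapD[OF assms])

lemma eval_eq_hom_ext: "eval p P = hom_ext (\<lambda>c. c) P p"
  by (simp add: eval_def hom_ext_def)

lemma ring_map_eval: "ring_map (\<lambda>p. eval p P)"
  unfolding eval_eq_hom_ext by (rule ring_map_hom_ext[OF ring_map_ident])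

lemma eval_single: "eval (Poly_Mapping.single u c) P = c * (\<Prod>i\<in>UNIV. P i ^ Poly_Mapping.lookup u i)"
  by (simp add: eval_eq_hom_ext hom_ext_single ring_map_ident)

lemma eval_Var: "eval (Var i) P = P i"
  by (simp add: eval_eq_hom_ext hom_ext_Var ring_map_ident)

text \<open>The \<open>K\<close>-algebra homomorphism that replaces the variable \<open>i\<close> by \<open>g i\<close>.\<close>

abbreviation substitute :: "('v::finite \<Rightarrow> ('w, 'a) mpoly) \<Rightarrow> ('v, 'a::field) mpoly \<Rightarrow> ('w, 'a) mpoly" where
  "substitute \<equiv> hom_ext (Poly_Mapping.single 0)"

lemmas ring_map_subst = ring_map_hom_ext[OF ring_map_const]

lemma subst_scal: "substitute g (scal c p) = scal c (substitute g p)"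
  by (simp add: scal_def ring_mapD[OF ring_map_subst] hom_ext_single ring_map_const)

lemma subst_const: "substitute g (Poly_Mapping.single 0 c) = Poly_Mapping.single 0 c"
  by (simp add: hom_ext_single ring_map_const)

lemma subst_subst: "substitute g (substitute g' p) = substitute (\<lambda>i. substitute g (g' i)) p"
  by (simp add: ring_map_comp_hom_ext[OF ring_map_subst, of g] subst_const)

lemma eval_const [simp]: "eval (Poly_Mapping.single 0 c) P = c"
  by (simp add: eval_single)

lemma eval_subst: "eval (substitute g p) P = eval p (\<lambda>i. eval (g i) P)"
  by (simp add: ring_map_comp_hom_ext[OF ring_map_eval] eval_eq_hom_ext[of p])

lemma prod_single:
  "finite A \<Longrightarrow> (\<Prod>i\<in>A. Poly_Mapping.single (f i) 1) = (Poly_Mapping.single (sum f A) 1 :: ('v, 'a::field) mpoly)"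
  by (induction A rule: finite_induct) (simp_all add: mult_single)

lemma Var_power: "Var i ^ k = Poly_Mapping.single (Poly_Mapping.single i k) 1"
  by (induction k) (simp_all add: Var_def mult_single flip: single_add)

lemma exponent_expand:
  "u = (\<Sum>i\<in>UNIV. Poly_Mapping.single i (Poly_Mapping.lookup u i))" for u :: "'v::finite \<Rightarrow>\<^sub>0 nat"
  by (rule poly_mapping_eqI) (simp add: lookup_sum lookup_single when_def)

lemma subst_Var [simp]: "substitute Var p = p"
proof -
  have "substitute Var p = (\<Sum>u\<in>Poly_Mapping.keys p. Poly_Mapping.single u (Poly_Mapping.lookup p u))"
    by (simp add: hom_ext_def Var_power prod_single mult_single flip: exponent_expand)
  then show ?thesis by (simp only: mpoly_expand[symmetric])
qed

subsection \<open>Forms\<close>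

lemma forms_iff: "p \<in> forms t \<longleftrightarrow> (\<forall>u\<in>Poly_Mapping.keys p. wt UNIV u = t)"
  by (simp add: forms_def wt_def)

lemma subspace_forms: "K.subspace (forms t :: ('v::finite, 'a::field) mpoly set)"
proof (rule K.subspaceI)
  fix p q :: "('v, 'a) mpoly" and c
  show "p \<in> forms t \<Longrightarrow> q \<in> forms t \<Longrightarrow> p + q \<in> forms t"
    unfolding forms_iff using keys_add[of p q] by blast
  show "p \<in> forms t \<Longrightarrow> scal c p \<in> forms t"
    unfolding forms_iff using keys_scal[of c p] by blast
qed (simp add: forms_iff)

lemma mult_forms: "p \<in> forms s \<Longrightarrow> q \<in> forms t \<Longrightarrow> p * q \<in> forms (s + t)"
  unfolding forms_iff using keys_mult[of p q] by (force simp: wt_add)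

lemma single_forms: "wt UNIV u = t \<Longrightarrow> Poly_Mapping.single u c \<in> forms t"
  unfolding forms_iff by simp

lemma one_forms: "1 \<in> forms 0"
  using single_forms[of 0 0 1] by simp

lemma power_forms: "p \<in> forms s \<Longrightarrow> p ^ k \<in> forms (k * s)"
  by (induction k) (auto simp: one_forms mult_forms)

lemma prod_forms: "finite A \<Longrightarrow> (\<And>i. i \<in> A \<Longrightarrow> f i \<in> forms (d i)) \<Longrightarrow> prod f A \<in> forms (sum d A)"
  by (induction A rule: finite_induct) (auto simp: one_forms mult_forms)

lemma Var_forms: "Var i \<in> forms 1"
  by (simp add: Var_def single_forms)

lemma subst_forms:
  assumes "\<And>i. g i \<in> forms 1" "p \<in> forms t"
  shows "substitute g p \<in> forms t"
  unfolding hom_ext_def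
proof (rule K.subspace_sum[OF subspace_forms])
  fix u assume u: "u \<in> Poly_Mapping.keys p"
  have "(\<Prod>i\<in>UNIV. g i ^ Poly_Mapping.lookup u i) \<in> forms (\<Sum>i\<in>UNIV. Poly_Mapping.lookup u i * 1)"
    by (intro prod_forms power_forms assms finite)
  moreover have "(\<Sum>i\<in>UNIV. Poly_Mapping.lookup u i * 1) = t"
    using assms(2) u by (simp add: forms_def)
  ultimately show "Poly_Mapping.single 0 (Poly_Mapping.lookup p u) *
      (\<Prod>i\<in>UNIV. g i ^ Poly_Mapping.lookup u i) \<in> forms t"
    using K.subspace_scale[OF subspace_forms] unfolding scal_def by metis
qed

lemma finite_wt_eq: "finite {u :: 'v::finite \<Rightarrow>\<^sub>0 nat. wt UNIV u = t}"
proof -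
  have "wt UNIV u = t \<Longrightarrow> Poly_Mapping.lookup u i \<le> t" for u :: "'v \<Rightarrow>\<^sub>0 nat" and i
    unfolding wt_def by (metis UNIV_I finite le0 member_le_sum)
  then have "Poly_Mapping.lookup ` {u :: 'v \<Rightarrow>\<^sub>0 nat. wt UNIV u = t} \<subseteq> {f. \<forall>i. f i \<in> {..t}}"
    by auto
  moreover have "finite {f :: 'v \<Rightarrow> nat. \<forall>i. f i \<in> {..t}}"
    using finite_set_of_finite_funs[OF finite[of "UNIV :: 'v set"] finite_atMost[of t]] by simp
  ultimately have "finite (Poly_Mapping.lookup ` {u :: 'v \<Rightarrow>\<^sub>0 nat. wt UNIV u = t})"
    by (rule finite_subset)
  then show ?thesis
    by (rule finite_imageD) (rule inj_onI, simp add: poly_mapping_eqI)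
qed

text \<open>An exponent of degree \<open>t\<close> is the same as a multiset of \<open>t\<close> variables.\<close>

lemma card_monomials:
  "card {u :: 'v::finite \<Rightarrow>\<^sub>0 nat. wt UNIV u = t} = (CARD('v) + t - 1) choose t"
proof -
  define e :: "('v \<Rightarrow>\<^sub>0 nat) \<Rightarrow> 'v multiset" where
    "e u = Abs_multiset (Poly_Mapping.lookup u)" for u
  have count_e: "count (e u) = Poly_Mapping.lookup u" for u
    unfolding e_def by (intro count_Abs_multiset) simp
  have size_e: "size (e u) = wt UNIV u" for u
    unfolding size_multiset_overloaded_eq wt_def count_e
    by (intro sum.mono_neutral_left) (auto simp: count_e not_in_iff)
  have "bij_betw e {u. wt UNIV u = t} (multisets_of_size UNIV t)"
  proof (rule bij_betw_imageI)
    show "inj_on e {u. wt UNIV u = t}"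
      by (intro inj_onI poly_mapping_eqI) (metis count_e)
    show "e ` {u. wt UNIV u = t} = multisets_of_size UNIV t"
    proof (intro equalityI subsetI)
      fix M assume M: "M \<in> multisets_of_size (UNIV :: 'v set) t"
      have "e (Abs_poly_mapping (count M)) = M"
        by (rule multiset_eqI) (simp add: count_e)
      then show "M \<in> e ` {u. wt UNIV u = t}"
        using M size_e[of "Abs_poly_mapping (count M)"]
        by (intro image_eqI[of _ _ "Abs_poly_mapping (count M)"]) (auto simp: multisets_of_size_def)
    qed (auto simp: multisets_of_size_def size_e)
  qed
  then have "card {u :: 'v \<Rightarrow>\<^sub>0 nat. wt UNIV u = t} = card (multisets_of_size (UNIV :: 'v set) t)"
    by (rule bij_betw_same_card)
  then show ?thesis by (simp add: card_multisets_of_size)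
qed

lemma inj_single_one: "inj (\<lambda>u. Poly_Mapping.single u 1 :: ('v, 'a::field) mpoly)"
  by (rule injI) (metis keys_single one_neq_zero singleton_inject)

lemma mem_span_monomials_iff:
  "p \<in> K.span ((\<lambda>u. Poly_Mapping.single u 1) ` S) \<longleftrightarrow> Poly_Mapping.keys p \<subseteq> S"
proof
  assume "p \<in> K.span ((\<lambda>u. Poly_Mapping.single u 1) ` S)"
  then show "Poly_Mapping.keys p \<subseteq> S"
  proof (induction rule: K.span_induct_alt)
    case (step c x y)
    then show ?case using keys_add[of "scal c x" y] keys_scal[of c x] by fastforce
  qed simp
next
  assume S: "Poly_Mapping.keys p \<subseteq> S"
  have "(\<Sum>u\<in>Poly_Mapping.keys p. Poly_Mapping.single u (Poly_Mapping.lookup p u))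
      \<in> K.span ((\<lambda>u. Poly_Mapping.single u 1) ` S)"
    using S by (intro K.span_sum) (metis K.span_base K.span_scale imageI single_eq_scal subsetD)
  then show "p \<in> K.span ((\<lambda>u. Poly_Mapping.single u 1) ` S)"
    by (simp only: mpoly_expand[symmetric])
qed

lemma independent_monomials:
  "K.independent ((\<lambda>u. Poly_Mapping.single u (1 :: 'a::field)) ` S)"
  unfolding K.dependent_def
proof safe
  fix u assume u: "u \<in> S" and
    "Poly_Mapping.single u (1::'a) \<in> K.span ((\<lambda>u. Poly_Mapping.single u 1) ` S - {Poly_Mapping.single u 1})"
  moreover have "(\<lambda>u. Poly_Mapping.single u (1::'a)) ` S - {Poly_Mapping.single u 1} =
      (\<lambda>u. Poly_Mapping.single u 1) ` (S - {u})"
    using inj_single_one[where 'a = 'a] by (auto simp: inj_on_def)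
  ultimately have "Poly_Mapping.keys (Poly_Mapping.single u (1::'a)) \<subseteq> S - {u}"
    by (simp only: mem_span_monomials_iff)
  then show False by simp
qed

lemma dim_monomials: "Kdim {p :: ('v, 'a::field) mpoly. Poly_Mapping.keys p \<subseteq> S} = card S"
proof -
  have "{p :: ('v, 'a) mpoly. Poly_Mapping.keys p \<subseteq> S} = K.span ((\<lambda>u. Poly_Mapping.single u 1) ` S)"
    using mem_span_monomials_iff by blast
  then show ?thesis
    by (simp add: K.dim_eq_card_independent[OF independent_monomials] card_image
        inj_on_subset[OF inj_single_one subset_UNIV])
qed

lemma forms_eq_monomials: "forms t = {p. Poly_Mapping.keys p \<subseteq> {u. wt UNIV u = t}}"
  by (auto simp: forms_iff)

lemma finite_spanning_forms:
  obtains E :: "('v::finite, 'a::field) mpoly set" where "finite E" "forms t \<subseteq> K.span E"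
proof
  show "finite ((\<lambda>u. Poly_Mapping.single u (1::'a)) ` {u :: 'v \<Rightarrow>\<^sub>0 nat. wt UNIV u = t})"
    by (intro finite_imageI finite_wt_eq)
  show "forms t \<subseteq> K.span ((\<lambda>u. Poly_Mapping.single u (1::'a)) ` {u :: 'v \<Rightarrow>\<^sub>0 nat. wt UNIV u = t})"
    by (auto simp: mem_span_monomials_iff forms_iff)
qed

subsection \<open>Powers of ideals generated by variables\<close>

text \<open>The polynomials all of whose terms have degree at least \<open>m\<close> in the variables from \<open>A\<close>. They
  form the \<open>m\<close>-th power of the ideal generated by these variables.\<close>

definition vanishing :: "'v set \<Rightarrow> nat \<Rightarrow> ('v::finite, 'a::field) mpoly set" where
  "vanishing A m = {p. \<forall>u\<in>Poly_Mapping.keys p. m \<le> wt A u}"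

lemma vanishing_iff:
  "p \<in> vanishing A m \<longleftrightarrow> (\<forall>u. wt A u < m \<longrightarrow> Poly_Mapping.lookup p u = 0)"
  by (auto simp: vanishing_def in_keys_iff simp flip: not_le)

lemma vanishing_mult: "p \<in> vanishing A k \<Longrightarrow> q \<in> vanishing A l \<Longrightarrow> p * q \<in> vanishing A (k + l)"
  unfolding vanishing_def using keys_mult[of p q] by (force simp: wt_add intro: add_mono)

lemma vanishing_0 [simp]: "vanishing A 0 = UNIV"
  by (simp add: vanishing_def)

lemma ideal_vanishing: "is_ideal (vanishing A m :: ('v::finite, 'a::field) mpoly set)"
proof (rule ideals.subspaceI)
  fix p q c :: "('v, 'a) mpoly"
  show "p \<in> vanishing A m \<Longrightarrow> q \<in> vanishing A m \<Longrightarrow> p + q \<in> vanishing A m"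
    unfolding vanishing_def using keys_add[of p q] by blast
  show "p \<in> vanishing A m \<Longrightarrow> c * p \<in> vanishing A m"
    using vanishing_mult[of c A 0 p m] by simp
qed (simp add: vanishing_def)

lemma Var_vanishing: "i \<in> A \<Longrightarrow> Var i \<in> vanishing A 1"
  by (simp add: vanishing_def Var_def)

lemma Var_mult_single: "Var i * Poly_Mapping.single v c = Poly_Mapping.single (Poly_Mapping.single i 1 + v) c"
  by (simp add: Var_def mult_single)

lemma additive_induct_mpoly:
  fixes p :: "('v, 'a::field) mpoly"
  assumes "G 0" and "\<And>p q. G p \<Longrightarrow> G q \<Longrightarrow> G (p + q)"
    and "\<And>u. u \<in> Poly_Mapping.keys p \<Longrightarrow> G (Poly_Mapping.single u (Poly_Mapping.lookup p u))"
  shows "G p"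
proof -
  have "G (\<Sum>u\<in>B. Poly_Mapping.single u (Poly_Mapping.lookup p u))"
    if "finite B" "B \<subseteq> Poly_Mapping.keys p" for B
    using that by (induction B rule: finite_induct) (auto simp: assms)
  then have "G (\<Sum>u\<in>Poly_Mapping.keys p. Poly_Mapping.single u (Poly_Mapping.lookup p u))"
    by simp
  then show ?thesis by (simp only: mpoly_expand[symmetric])
qed

text \<open>Every element of \<open>vanishing A (Suc m)\<close> is a sum of products of a variable from \<open>A\<close> with an
  element of \<open>vanishing A m\<close>.\<close>

lemma vanishing_Suc_induct [consumes 1, case_names zero add mult]:
  assumes "p \<in> vanishing A (Suc m)"
    and "G 0" "\<And>p q. G p \<Longrightarrow> G q \<Longrightarrow> G (p + q)"
    and "\<And>i q. i \<in> A \<Longrightarrow> q \<in> vanishing A m \<Longrightarrow> G (Var i * q)"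
  shows "G p"
proof (rule additive_induct_mpoly[of G, OF assms(2,3)])
  fix u assume "u \<in> Poly_Mapping.keys p"
  then have u: "Suc m \<le> wt A u" using assms(1) by (simp add: vanishing_def)
  then obtain i v where iv: "i \<in> A" "u = Poly_Mapping.single i 1 + v"
    using wt_pos_split[of A u] by auto
  then have "Poly_Mapping.single v (Poly_Mapping.lookup p u) \<in> vanishing A m"
    using u by (simp add: vanishing_def wt_add)
  then have "G (Var i * Poly_Mapping.single v (Poly_Mapping.lookup p u))"
    by (rule assms(4)[OF iv(1)])
  then show "G (Poly_Mapping.single u (Poly_Mapping.lookup p u))"
    unfolding Var_mult_single iv(2) .
qed

lemma vanishing_forms_eq:
  "vanishing A m \<inter> forms t = {p. Poly_Mapping.keys p \<subseteq> {u. wt UNIV u = t \<and> m \<le> wt A u}}"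
  by (auto simp: vanishing_def forms_iff)

text \<open>The monomials of degree \<open>t\<close> outside \<open>vanishing (- {i}) m\<close> are the multiples of the
  \<open>(t - m + 1)\<close>-th power of the variable \<open>i\<close>, so there are as many of them as monomials of degree
  \<open>m - 1\<close>.\<close>

lemma dim_vanishing_forms:
  assumes "1 \<le> m" "m \<le> t"
  shows "Kdim (vanishing (- {i}) m \<inter> forms t :: ('v::finite, 'a::field) mpoly set)
    + card {u :: 'v \<Rightarrow>\<^sub>0 nat. wt UNIV u = m - 1} = Kdim (forms t :: ('v, 'a) mpoly set)"
proof -
  define L :: "('v \<Rightarrow>\<^sub>0 nat) set" where "L = {u. wt UNIV u = t \<and> m \<le> wt (- {i}) u}"
  define S :: "('v \<Rightarrow>\<^sub>0 nat) set" where "S = {u. wt UNIV u = t \<and> wt (- {i}) u < m}"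
  define sh :: "('v \<Rightarrow>\<^sub>0 nat) \<Rightarrow> 'v \<Rightarrow>\<^sub>0 nat" where "sh u = Poly_Mapping.single i (t - (m - 1)) + u" for u
  have "sh ` {u. wt UNIV u = m - 1} = S"
  proof (intro equalityI subsetI)
    fix u assume u: "u \<in> S"
    define v where "v = u - Poly_Mapping.single i (t - (m - 1))"
    have "Poly_Mapping.lookup u i \<ge> t - (m - 1)"
      using u wt_UNIV_eq[of u i] assms by (auto simp: S_def)
    then have uv: "u = sh v"
      unfolding sh_def v_def
      by (intro poly_mapping_eqI) (auto simp: lookup_add lookup_minus lookup_single when_def)
    then have "wt UNIV u = (t - (m - 1)) + wt UNIV v"
      unfolding sh_def by (simp add: wt_add)
    moreover have "wt UNIV u = t"
      using u by (simp add: S_def)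
    ultimately have "wt UNIV v = m - 1"
      using assms by arith
    then show "u \<in> sh ` {u. wt UNIV u = m - 1}" using uv by blast
  next
    fix u assume "u \<in> sh ` {u. wt UNIV u = m - 1}"
    then obtain v where v: "u = sh v" "wt UNIV v = m - 1" by blast
    then have "wt (- {i}) v < m" using wt_UNIV_eq[of v i] assms by simp
    then show "u \<in> S" using v assms by (simp add: S_def sh_def wt_add)
  qed
  moreover have "inj sh" by (rule injI) (simp add: sh_def)
  ultimately have "card {u :: 'v \<Rightarrow>\<^sub>0 nat. wt UNIV u = m - 1} = card S"
    by (metis card_image inj_on_subset subset_UNIV)
  moreover have "{u :: 'v \<Rightarrow>\<^sub>0 nat. wt UNIV u = t} = L \<union> S" "L \<inter> S = {}"
    by (auto simp: L_def S_def)
  moreover have "finite (L \<union> S)"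
    using finite_wt_eq[where 'v = 'v] calculation(2) by metis
  ultimately show ?thesis
    unfolding vanishing_forms_eq unfolding forms_eq_monomials dim_monomials
    by (simp add: L_def[symmetric] card_Un_disjoint)
qed

text \<open>A form of degree \<open>t\<close> lies in \<open>vanishing (- {i}) t\<close> if and only if it does not contain the
  variable \<open>i\<close>. So the following says: if modulo \<open>J\<close> the variable \<open>i\<close> can be removed from all forms
  of degree \<open>a\<close>, then it can be removed from all forms of larger degree.\<close>

lemma vanishing_complement_propagates:
  fixes J :: "('v::finite, 'a::field) mpoly set"
  assumes J: "is_ideal J" and "1 \<le> a" "a \<le> t"
    and "forms a \<subseteq> {x + y | x y. x \<in> J \<and> y \<in> vanishing (- {i}) a \<inter> forms a}"
  shows "forms t \<subseteq> {x + y | x y. x \<in> J \<and> y \<in> vanishing (- {i}) t \<inter> forms t}"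
  using \<open>a \<le> t\<close>
proof (induction t rule: dec_induct)
  case base
  then show ?case using assms(4) .
next
  case (step t)
  define S where "S k = {x + y | x y. x \<in> J \<and> y \<in> vanishing (- {i}) k \<inter> forms k}" for k
  have IH: "forms t \<subseteq> S t" using step.IH S_def by simp
  have sub: "K.subspace (S k)" for k
    unfolding S_def by (intro K.subspace_sums K.subspace_inter subspace_ideal J ideal_vanishing
        subspace_forms)
  have JS: "x \<in> S k" if "x \<in> J" for x k
  proof -
    have "x = x + 0" "0 \<in> vanishing (- {i}) k \<inter> forms k"
      by (simp_all add: K.subspace_0[OF subspace_forms] ideals.subspace_0[OF ideal_vanishing])
    then show ?thesis unfolding S_def using that by blast
  qed
  \<comment> \<open>Split off a variable \<open>j \<noteq> i\<close> and remove \<open>i\<close> from the cofactor.\<close>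
  have other: "Poly_Mapping.single u c \<in> S (Suc t)" if u: "wt UNIV u = Suc t" "wt (- {i}) u > 0" for u c
  proof -
    obtain j v where jv: "j \<in> - {i}" "u = Poly_Mapping.single j 1 + v"
      using u(2) by (rule wt_pos_split)
    then have "wt UNIV v = t" using u(1) by (simp add: wt_add)
    then have "Poly_Mapping.single v c \<in> S t" using IH single_forms by blast
    then obtain x y where xy: "Poly_Mapping.single v c = x + y" "x \<in> J" "y \<in> vanishing (- {i}) t" "y \<in> forms t"
      by (auto simp: S_def)
    have "Poly_Mapping.single u c = Var j * x + Var j * y"
      unfolding jv(2) Var_mult_single[symmetric] xy(1) by (rule distrib_left)
    moreover have "Var j * x \<in> J" using J xy(2) by (rule ideal_mult_left)
    moreover have "Var j * y \<in> vanishing (- {i}) (Suc t)" "Var j * y \<in> forms (Suc t)"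
      using vanishing_mult[OF Var_vanishing[OF jv(1)] xy(3)] mult_forms[OF Var_forms xy(4)] by simp_all
    ultimately show ?thesis unfolding S_def by blast
  qed
  have mono: "Poly_Mapping.single u c \<in> S (Suc t)" if u: "wt UNIV u = Suc t" for u c
  proof (cases "wt (- {i}) u > 0")
    case False
    \<comment> \<open>Here \<open>u\<close> is a power of the variable \<open>i\<close>. Removing \<open>i\<close> from the cofactor of one factor \<open>i\<close>
      leaves monomials that contain another variable, because the cofactor has degree \<open>t \<ge> 1\<close>.\<close>
    then have "Poly_Mapping.lookup u i > 0" using u wt_UNIV_eq[of u i] by simp
    then obtain v where v: "u = Poly_Mapping.single i 1 + v" by (rule lookup_pos_split)
    then have "wt UNIV v = t" using u by (simp add: wt_add)
    then have "Poly_Mapping.single v c \<in> S t" using IH single_forms by blast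
    then obtain x y where xy: "Poly_Mapping.single v c = x + y" "x \<in> J" "y \<in> vanishing (- {i}) t" "y \<in> forms t"
      by (auto simp: S_def)
    have "Poly_Mapping.single u c = Var i * x + Var i * y"
      unfolding v Var_mult_single[symmetric] xy(1) by (rule distrib_left)
    moreover have "Var i * x \<in> S (Suc t)" using JS J xy(2) ideal_mult_left by blast
    moreover have "Var i * y \<in> S (Suc t)"
    proof (rule additive_induct_mpoly[of "\<lambda>q. Var i * q \<in> S (Suc t)"])
      fix w assume w: "w \<in> Poly_Mapping.keys y"
      then have "wt (- {i}) w > 0" "wt UNIV w = t"
        using xy(3,4) \<open>1 \<le> a\<close> step.hyps(1) by (auto simp: vanishing_def forms_iff)
      then show "Var i * Poly_Mapping.single w (Poly_Mapping.lookup y w) \<in> S (Suc t)"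
        unfolding Var_mult_single by (intro other) (simp_all add: wt_add)
    qed (auto simp: distrib_left K.subspace_0[OF sub] K.subspace_add[OF sub])
    ultimately show ?thesis by (simp add: K.subspace_add[OF sub])
  qed (use u other in blast)
  have "p \<in> S (Suc t)" if "p \<in> forms (Suc t)" for p
    by (rule additive_induct_mpoly[of "\<lambda>q. q \<in> S (Suc t)"])
      (use that in \<open>auto simp: forms_iff mono K.subspace_0[OF sub] K.subspace_add[OF sub]\<close>)
  then show ?case by (auto simp: S_def)
qed

section \<open>The ideal of a point and its powers\<close>

text \<open>A linear substitution under which the ideal of \<open>P\<close> becomes the ideal generated by the variables
  other than \<open>i\<close>, provided that \<open>P i \<noteq> 0\<close>. Its coefficients are linear forms in the coordinates
  of \<open>P\<close>; for this reason \<open>P i\<close> is not normalised to \<open>1\<close>.\<close>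

definition chart :: "'v \<Rightarrow> ('v \<Rightarrow> 'a) \<Rightarrow> ('v::finite, 'a::field) mpoly \<Rightarrow> ('v, 'a) mpoly" where
  "chart i P = substitute (\<lambda>j. scal (P i) (Var j) + scal (if j = i then 0 else P j) (Var i))"

text \<open>The inverse of \<open>chart i P\<close> when \<open>P i \<noteq> 0\<close>.\<close>

definition unchart :: "'v \<Rightarrow> ('v \<Rightarrow> 'a) \<Rightarrow> ('v::finite, 'a::field) mpoly \<Rightarrow> ('v, 'a) mpoly" where
  "unchart i P = substitute (\<lambda>j. scal (1 / P i) (Var j) - scal (if j = i then 0 else P j / (P i)\<^sup>2) (Var i))"

lemma ring_map_chart: "ring_map (chart i P)" and ring_map_unchart: "ring_map (unchart i P)"
  unfolding chart_def unchart_def by (rule ring_map_subst)+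

lemma chart_scal: "chart i P (scal c p) = scal c (chart i P p)"
  and unchart_scal: "unchart i P (scal c p) = scal c (unchart i P p)"
  unfolding chart_def unchart_def by (rule subst_scal)+

lemma linear_form: "scal c (Var j) + scal d (Var i) \<in> forms 1"
  "scal c (Var j) - scal d (Var i) \<in> forms 1"
  by (intro K.subspace_add K.subspace_diff K.subspace_scale subspace_forms Var_forms)+

lemma chart_forms: "p \<in> forms t \<Longrightarrow> chart i P p \<in> forms t"
  and unchart_forms: "p \<in> forms t \<Longrightarrow> unchart i P p \<in> forms t"
  unfolding chart_def unchart_def by (intro subst_forms linear_form; assumption)+

lemma chart_Var: "chart i P (Var j) = scal (P i) (Var j) + scal (if j = i then 0 else P j) (Var i)"
  and unchart_Var:
    "unchart i P (Var j) = scal (1 / P i) (Var j) - scal (if j = i then 0 else P j / (P i)\<^sup>2) (Var i)"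
  unfolding chart_def unchart_def by (simp_all add: hom_ext_Var ring_map_const)

lemma unchart_chart:
  assumes "P i \<noteq> 0" shows "unchart i P (chart i P p) = p"
proof -
  have "unchart i P (chart i P (Var j)) = Var j" for j
    using assms
    by (simp add: chart_Var ring_mapD(3)[OF ring_map_unchart] unchart_scal unchart_Var
        K.scale_right_diff_distrib power2_eq_square)
  moreover have "unchart i P (chart i P p) = substitute (\<lambda>j. unchart i P (chart i P (Var j))) p"
    unfolding chart_def unchart_def subst_subst by (simp add: hom_ext_Var ring_map_const)
  ultimately show ?thesis by simp
qed

lemma chart_unchart:
  assumes "P i \<noteq> 0" shows "chart i P (unchart i P p) = p"
proof -
  have "chart i P (unchart i P (Var j)) = Var j" for j
    using assms
    by (simp add: unchart_Var ring_map_diff[OF ring_map_chart] chart_scal chart_Var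
        K.scale_right_distrib power2_eq_square)
  moreover have "chart i P (unchart i P p) = substitute (\<lambda>j. chart i P (unchart i P (Var j))) p"
    unfolding chart_def unchart_def subst_subst by (simp add: hom_ext_Var ring_map_const)
  ultimately show ?thesis by simp
qed

text \<open>In the new coordinates the point \<open>P\<close> is the coordinate point \<open>i\<close>.\<close>

lemma eval_chart:
  fixes p :: "('v::finite, 'a::field) mpoly"
  shows "eval (chart i P p) (\<lambda>j. if j = i then 1 else 0) = eval p P"
proof -
  have eval_scal: "eval (scal c p) Q = c * eval p Q" for c Q and p :: "('v, 'a) mpoly"
    by (simp add: scal_def ring_mapD(4)[OF ring_map_eval])
  show ?thesis
    unfolding chart_def eval_subst
    by (rule arg_cong[of _ _ "eval p"]) (auto simp: ring_mapD(3)[OF ring_map_eval] eval_scal eval_Var)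
qed

text \<open>The value of a form of degree \<open>t\<close> at the coordinate point \<open>i\<close> is its coefficient at the
  \<open>t\<close>-th power of the variable \<open>i\<close>.\<close>

lemma eval_eq_0_iff_vanishing:
  fixes p :: "('v::finite, 'a::field) mpoly"
  assumes "p \<in> forms t"
  shows "eval p (\<lambda>j. if j = i then 1 else 0) = 0 \<longleftrightarrow> p \<in> vanishing (- {i}) 1"
proof -
  have prod: "(\<Prod>j\<in>UNIV. (if j = i then 1 else 0 :: 'a) ^ Poly_Mapping.lookup u j)
      = (if u = Poly_Mapping.single i t then 1 else 0)"
    if "u \<in> Poly_Mapping.keys p" for u
  proof (cases "wt (- {i}) u = 0")
    case True
    then have "Poly_Mapping.lookup u j = 0" if "j \<noteq> i" for j
      using that by (simp add: wt_def)
    moreover from True have "Poly_Mapping.lookup u i = t"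
      using assms \<open>u \<in> Poly_Mapping.keys p\<close> wt_UNIV_eq[of u i] by (simp add: forms_iff)
    ultimately show ?thesis
      by (auto intro!: prod.neutral poly_mapping_eqI simp: lookup_single when_def)
  next
    case False
    then obtain j where j: "j \<noteq> i" "Poly_Mapping.lookup u j \<noteq> 0"
      by (auto simp: wt_def)
    then have "u \<noteq> Poly_Mapping.single i t" by (auto simp: lookup_single)
    moreover have "(\<Prod>j\<in>UNIV. (if j = i then 1 else 0 :: 'a) ^ Poly_Mapping.lookup u j) = 0"
      using j by (intro prod_zero) (auto intro!: bexI[of _ j])
    ultimately show ?thesis by simp
  qed
  have "eval p (\<lambda>j. if j = i then 1 else 0) =
      (\<Sum>u\<in>Poly_Mapping.keys p. if u = Poly_Mapping.single i t then Poly_Mapping.lookup p u else 0)"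
    unfolding eval_def by (intro sum.cong) (auto simp: prod)
  also have "\<dots> = Poly_Mapping.lookup p (Poly_Mapping.single i t)"
    by (simp add: in_keys_iff)
  finally have ev: "eval p (\<lambda>j. if j = i then 1 else 0) = Poly_Mapping.lookup p (Poly_Mapping.single i t)" .
  show ?thesis
  proof
    assume "eval p (\<lambda>j. if j = i then 1 else 0) = 0"
    then have no: "Poly_Mapping.single i t \<notin> Poly_Mapping.keys p"
      using ev by (simp add: in_keys_iff)
    show "p \<in> vanishing (- {i}) 1"
      unfolding vanishing_def
    proof safe
      fix u assume u: "u \<in> Poly_Mapping.keys p"
      show "1 \<le> wt (- {i}) u"
      proof (rule ccontr)
        assume "\<not> 1 \<le> wt (- {i}) u"
        then have z: "wt (- {i}) u = 0" by simp
        then have "Poly_Mapping.lookup u j = 0" if "j \<noteq> i" for j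
          using that by (simp add: wt_def)
        moreover have "Poly_Mapping.lookup u i = t"
          using z assms u wt_UNIV_eq[of u i] by (simp add: forms_iff)
        ultimately have "u = Poly_Mapping.single i t"
          by (auto intro!: poly_mapping_eqI simp: lookup_single when_def)
        then show False using u no by simp
      qed
    qed
  next
    assume "p \<in> vanishing (- {i}) 1"
    then have "Poly_Mapping.single i t \<notin> Poly_Mapping.keys p"
      unfolding vanishing_def by force
    then show "eval p (\<lambda>j. if j = i then 1 else 0) = 0"
      using ev by (simp add: in_keys_iff)
  qed
qed

lemma ideal_chart_vanishing: "is_ideal {p. chart i P p \<in> vanishing A m}"
  by (intro ideals.subspaceI)
    (auto simp: ring_mapD[OF ring_map_chart] ideals.subspace_0[OF ideal_vanishing]
      ideals.subspace_add[OF ideal_vanishing] ideal_mult_left[OF ideal_vanishing])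

lemma point_ideal_eq:
  assumes P: "P i \<noteq> 0"
  shows "point_ideal P = {p. chart i P p \<in> vanishing (- {i}) 1}"
proof
  show "point_ideal P \<subseteq> {p. chart i P p \<in> vanishing (- {i}) 1}"
    unfolding point_ideal_def
  proof (rule ideals.span_minimal[OF _ ideal_chart_vanishing], safe)
    fix f t assume "f \<in> forms t" "eval f P = 0"
    then show "chart i P f \<in> vanishing (- {i}) 1"
      using eval_eq_0_iff_vanishing[OF chart_forms] eval_chart by metis
  qed
  have "unchart i P q \<in> point_ideal P" if "q \<in> vanishing (- {i}) (Suc 0)" for q
    using that
  proof (induction rule: vanishing_Suc_induct)
    case zero
    then show ?case
      by (simp add: ring_mapD[OF ring_map_unchart] point_ideal_def ideals.span_zero)
  next
    case (add p q)
    then show ?case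
      by (simp add: ring_mapD[OF ring_map_unchart] point_ideal_def ideals.span_add)
  next
    case (mult j q)
    have "eval (unchart i P (Var j)) P = eval (Var j) (\<lambda>k. if k = i then 1 else 0)"
      using eval_chart[of i P "unchart i P (Var j)"] chart_unchart[of P i, OF P] by simp
    also have "\<dots> = 0"
      using eval_eq_0_iff_vanishing[OF Var_forms] Var_vanishing[OF mult(1)] by blast
    finally have "unchart i P (Var j) \<in> point_ideal P"
      unfolding point_ideal_def using unchart_forms[OF Var_forms] by (blast intro: ideals.span_base)
    then show ?case
      unfolding ring_mapD(4)[OF ring_map_unchart] point_ideal_def
      by (subst mult.commute) (rule ideals.span_scale)
  qed
  then show "{p. chart i P p \<in> vanishing (- {i}) 1} \<subseteq> point_ideal P"
    by (metis One_nat_def mem_Collect_eq subsetI unchart_chart[of P i, OF P])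
qed

lemma ideal_pow_point_ideal_eq:
  assumes P: "P i \<noteq> 0"
  shows "ideal_pow (point_ideal P) m = {p. chart i P p \<in> vanishing (- {i}) m}"
proof (induction m)
  case 0
  then show ?case by simp
next
  case (Suc m)
  let ?G = "{a * b | a b. a \<in> point_ideal P \<and> b \<in> ideal_pow (point_ideal P) m}"
  have "ideal_gen ?G \<subseteq> {p. chart i P p \<in> vanishing (- {i}) (Suc m)}"
    unfolding Suc unfolding point_ideal_eq[of P i, OF P]
    by (rule ideals.span_minimal[OF _ ideal_chart_vanishing])
      (use vanishing_mult[of _ "- {i}" 1 _ m] in \<open>auto simp: ring_mapD(4)[OF ring_map_chart]\<close>)
  moreover have "unchart i P q \<in> ideal_gen ?G" if "q \<in> vanishing (- {i}) (Suc m)" for q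
    using that
  proof (induction rule: vanishing_Suc_induct)
    case zero
    then show ?case by (simp add: ring_mapD[OF ring_map_unchart] ideals.span_zero)
  next
    case (add p q)
    then show ?case by (simp add: ring_mapD[OF ring_map_unchart] ideals.span_add)
  next
    case (mult j q)
    have "unchart i P (Var j) \<in> point_ideal P"
      using Var_vanishing[OF mult(1)] by (simp add: point_ideal_eq[of P i, OF P] chart_unchart[of P i, OF P])
    moreover have "unchart i P q \<in> ideal_pow (point_ideal P) m"
      using mult(2) by (simp add: Suc chart_unchart[of P i, OF P])
    ultimately show ?case
      unfolding ring_mapD(4)[OF ring_map_unchart] by (blast intro: ideals.span_base)
  qed
  ultimately show ?case
    unfolding ideal_pow.simps by (metis (no_types, lifting) mem_Collect_eq subsetI subset_antisym unchart_chart[of P i, OF P])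
qed

lemma ideal_ideal_pow_point:
  assumes "P \<noteq> (\<lambda>_. 0)" shows "is_ideal (ideal_pow (point_ideal P) m)"
proof -
  obtain i where "P i \<noteq> 0" using assms by auto
  then show ?thesis using ideal_pow_point_ideal_eq ideal_chart_vanishing by metis
qed

lemma degree_part_ideal_pow_point_eq_image:
  assumes P: "P i \<noteq> 0"
  shows "degree_part (ideal_pow (point_ideal P) m) t = unchart i P ` (vanishing (- {i}) m \<inter> forms t)"
proof
  show "degree_part (ideal_pow (point_ideal P) m) t \<subseteq> unchart i P ` (vanishing (- {i}) m \<inter> forms t)"
  proof
    fix p assume "p \<in> degree_part (ideal_pow (point_ideal P) m) t"
    then have "chart i P p \<in> vanishing (- {i}) m \<inter> forms t"
      unfolding degree_part_def ideal_pow_point_ideal_eq[of P i, OF P] by (auto intro: chart_forms)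
    then show "p \<in> unchart i P ` (vanishing (- {i}) m \<inter> forms t)"
      using unchart_chart[of P i p, OF P] by (metis image_eqI)
  qed
  show "unchart i P ` (vanishing (- {i}) m \<inter> forms t) \<subseteq> degree_part (ideal_pow (point_ideal P) m) t"
    unfolding degree_part_def ideal_pow_point_ideal_eq[of P i, OF P]
    by (auto simp: chart_unchart[of P i, OF P] unchart_forms)
qed

lemma Kdim_injective_image:
  assumes "module_hom scal scal T" "inj T"
  shows "Kdim (T ` W) = Kdim W"
proof -
  interpret T: module_hom scal scal T by fact
  obtain B where B: "B \<subseteq> W" "K.independent B" "W \<subseteq> K.span B" "card B = Kdim W"
    using K.basis_exists by blast
  have "card (T ` B) = Kdim (T ` W)"
    using B assms(2)
    by (intro K.basis_card_eq_dim T.spans_image image_mono T.independent_injective_image)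
      (auto intro: inj_on_subset)
  then show ?thesis using B(4) assms(2) by (simp add: card_image inj_on_subset)
qed

text \<open>With \<open>CARD('v) = n + 1\<close> the codimension is \<open>(m + n - 1) choose n\<close>: the
  conditions that a point of multiplicity \<open>m\<close> imposes on forms of degree \<open>t \<ge> m\<close> are independent.\<close>

lemma codim_ideal_pow_point:
  fixes P :: "'v::finite \<Rightarrow> 'a::field"
  assumes "P \<noteq> (\<lambda>_. 0)" "1 \<le> m" "m \<le> t"
  shows "Kdim (degree_part (ideal_pow (point_ideal P) m) t) + ((m + (CARD('v) - 1) - 1) choose (CARD('v) - 1))
    = Kdim (forms t :: ('v, 'a) mpoly set)"
proof -
  obtain i where i: "P i \<noteq> 0" using assms(1) by auto
  have "module_hom scal scal (unchart i P)"
    by unfold_locales (simp_all add: ring_mapD[OF ring_map_unchart] unchart_scal K.scale_right_distrib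
        K.scale_left_distrib)
  moreover have "inj (unchart i P)"
    using chart_unchart[of P i, OF i] by (metis injI)
  ultimately have "Kdim (degree_part (ideal_pow (point_ideal P) m) t) =
      Kdim (vanishing (- {i}) m \<inter> forms t :: ('v, 'a) mpoly set)"
    unfolding degree_part_ideal_pow_point_eq_image[of P i, OF i] by (rule Kdim_injective_image)
  moreover have "card {u :: 'v \<Rightarrow>\<^sub>0 nat. wt UNIV u = m - 1} = (m + (CARD('v) - 1) - 1) choose (CARD('v) - 1)"
  proof -
    have "CARD('v) > 0" by simp
    then have "CARD('v) + (m - 1) - 1 = (CARD('v) - 1) + (m - 1)"
      "m + (CARD('v) - 1) - 1 = (CARD('v) - 1) + (m - 1)" using assms(2) by linarith+
    then show ?thesis
      unfolding card_monomials by (metis add_diff_cancel_left' binomial_symmetric le_add1)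
  qed
  ultimately show ?thesis using dim_vanishing_forms[OF assms(2,3), of i, where 'a = 'a] by simp
qed

lemma degree_part_ideal_pow_point_trivial:
  fixes P :: "'v::finite \<Rightarrow> 'a::field"
  assumes "P \<noteq> (\<lambda>_. 0)" "t < m"
  shows "degree_part (ideal_pow (point_ideal P) m) t = {0}"
proof -
  obtain i where i: "P i \<noteq> 0" using assms(1) by auto
  have "{u. wt UNIV u = t \<and> m \<le> wt (- {i}) u} = {}"
    using wt_UNIV_eq[of _ i] assms(2) by auto
  then have "vanishing (- {i}) m \<inter> forms t = {0 :: ('v, 'a) mpoly}"
    unfolding vanishing_forms_eq by (auto intro!: poly_mapping_eqI simp: in_keys_iff set_eq_iff)
  then show ?thesis
    unfolding degree_part_ideal_pow_point_eq_image[of P i, OF i]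
    by (simp add: ring_mapD[OF ring_map_unchart])
qed

text \<open>The propagation of \<open>[I]\<^sub>t + [I\<^sub>P\<^sup>t]\<^sub>t = [R]\<^sub>t\<close> to larger \<open>t\<close>, and to smaller multiplicities.\<close>

lemma sum_point_ideal_propagates:
  fixes I :: "('v::finite, 'a::field) mpoly set"
  assumes I: "is_ideal I" and P: "P \<noteq> (\<lambda>_. 0)" and "1 \<le> a" "a \<le> t" "m \<le> t"
    and eq: "{x + y | x y. x \<in> degree_part I a \<and> y \<in> degree_part (ideal_pow (point_ideal P) a) a} = forms a"
  shows "{x + y | x y. x \<in> degree_part I t \<and> y \<in> degree_part (ideal_pow (point_ideal P) m) t} = forms t"
proof
  obtain i where i: "P i \<noteq> 0" using P by auto
  define J where "J = {q. unchart i P q \<in> I}"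
  have J: "is_ideal J"
    unfolding J_def using I
    by (intro ideals.subspaceI)
      (auto simp: ring_mapD[OF ring_map_unchart] ideals.subspace_0 ideals.subspace_add ideal_mult_left)
  have "forms a \<subseteq> {x + y | x y. x \<in> J \<and> y \<in> vanishing (- {i}) a \<inter> forms a}"
  proof
    fix p :: "('v, 'a) mpoly" assume "p \<in> forms a"
    then have "unchart i P p \<in>
        {x + y | x y. x \<in> degree_part I a \<and> y \<in> degree_part (ideal_pow (point_ideal P) a) a}"
      unfolding eq by (rule unchart_forms)
    then obtain x y where xy: "unchart i P p = x + y" "x \<in> I" "y \<in> forms a"
      "chart i P y \<in> vanishing (- {i}) a"
      unfolding ideal_pow_point_ideal_eq[of P i, OF i] degree_part_def by blast
    have "p = chart i P x + chart i P y"
      using arg_cong[OF xy(1), of "chart i P"] by (simp add: chart_unchart[of P i, OF i] ring_mapD[OF ring_map_chart])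
    moreover have "chart i P x \<in> J" using xy(2) by (simp add: J_def unchart_chart[of P i, OF i])
    ultimately show "p \<in> {x + y | x y. x \<in> J \<and> y \<in> vanishing (- {i}) a \<inter> forms a}"
      using xy(4) chart_forms[OF xy(3)] by blast
  qed
  then have S: "forms t \<subseteq> {x + y | x y. x \<in> J \<and> y \<in> vanishing (- {i}) t \<inter> forms t}"
    by (rule vanishing_complement_propagates[OF J \<open>1 \<le> a\<close> \<open>a \<le> t\<close>])
  show "forms t \<subseteq> {x + y | x y. x \<in> degree_part I t \<and> y \<in> degree_part (ideal_pow (point_ideal P) m) t}"
  proof
    fix p :: "('v, 'a) mpoly" assume p: "p \<in> forms t"
    then obtain x y where xy: "chart i P p = x + y" "x \<in> J" "y \<in> forms t" "y \<in> vanishing (- {i}) t"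
      using S chart_forms[OF p, of i P] by blast
    have "p = unchart i P x + unchart i P y"
      using arg_cong[OF xy(1), of "unchart i P"] by (simp add: unchart_chart[of P i, OF i] ring_mapD[OF ring_map_unchart])
    moreover have y: "unchart i P y \<in> forms t" using xy(3) by (rule unchart_forms)
    moreover have "unchart i P x \<in> forms t"
      using calculation K.subspace_diff[OF subspace_forms p y] by simp
    moreover have "y \<in> vanishing (- {i}) m" using xy(4) \<open>m \<le> t\<close> by (auto simp: vanishing_def)
    then have "unchart i P y \<in> ideal_pow (point_ideal P) m"
      by (simp add: ideal_pow_point_ideal_eq[of P i, OF i] chart_unchart[of P i, OF i])
    ultimately show "p \<in> {x + y | x y. x \<in> degree_part I t \<and> y \<in> degree_part (ideal_pow (point_ideal P) m) t}"
      using xy(2) unfolding degree_part_def J_def by blast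
  qed
  show "{x + y | x y. x \<in> degree_part I t \<and> y \<in> degree_part (ideal_pow (point_ideal P) m) t} \<subseteq> forms t"
    unfolding degree_part_def using K.subspace_add[OF subspace_forms] by blast
qed

section \<open>Semicontinuity on projective space\<close>

text \<open>The functions on affine space given by forms of degree \<open>d\<close>.\<close>

definition form_fun :: "nat \<Rightarrow> (('v::finite \<Rightarrow> 'a::field) \<Rightarrow> 'a) set" where
  "form_fun d = {h. \<exists>f\<in>forms d. h = (\<lambda>P. eval f P)}"

lemma form_fun_add:
  assumes "g \<in> form_fun d" "h \<in> form_fun d"
  shows "(\<lambda>P. g P + h P) \<in> form_fun d"
proof -
  obtain p q where "p \<in> forms d" "q \<in> forms d" "g = (\<lambda>P. eval p P)" "h = (\<lambda>P. eval q P)"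
    using assms by (auto simp: form_fun_def)
  then show ?thesis
    unfolding form_fun_def
    by (auto intro!: bexI[of _ "p + q"] K.subspace_add[OF subspace_forms]
        simp: ring_mapD(3)[OF ring_map_eval])
qed

lemma form_fun_mult:
  assumes "g \<in> form_fun d" "h \<in> form_fun e"
  shows "(\<lambda>P. g P * h P) \<in> form_fun (d + e)"
proof -
  obtain p q where "p \<in> forms d" "q \<in> forms e" "g = (\<lambda>P. eval p P)" "h = (\<lambda>P. eval q P)"
    using assms by (auto simp: form_fun_def)
  then show ?thesis
    unfolding form_fun_def
    by (auto intro!: bexI[of _ "p * q"] mult_forms simp: ring_mapD(4)[OF ring_map_eval])
qed

lemma form_fun_const: "(\<lambda>P. c) \<in> form_fun 0"
  unfolding form_fun_def
  by (auto intro!: bexI[of _ "Poly_Mapping.single 0 c"] single_forms)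

lemma form_fun_const_mult: "h \<in> form_fun d \<Longrightarrow> (\<lambda>P. c * h P) \<in> form_fun d"
  using form_fun_mult[OF form_fun_const, of h d c] by simp

lemma form_fun_zero: "(\<lambda>P. 0) \<in> form_fun d"
  unfolding form_fun_def
  by (auto intro!: bexI[of _ 0] K.subspace_0[OF subspace_forms] simp: ring_mapD(1)[OF ring_map_eval])

lemma form_fun_diff:
  "g \<in> form_fun d \<Longrightarrow> h \<in> form_fun d \<Longrightarrow> (\<lambda>P. g P - h P) \<in> form_fun d"
  using form_fun_add[of g d "\<lambda>P. (- 1) * h P"] form_fun_const_mult[of h d "- 1"] by simp

lemma form_fun_sum:
  "(\<And>x. x \<in> A \<Longrightarrow> h x \<in> form_fun d) \<Longrightarrow> (\<lambda>P. \<Sum>x\<in>A. h x P) \<in> form_fun d"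
  by (induction A rule: infinite_finite_induct) (auto simp: form_fun_zero intro!: form_fun_add)

lemma form_fun_coordinate: "(\<lambda>P. P i) \<in> form_fun 1"
proof -
  have "(\<lambda>P. P i) = (\<lambda>P. eval (Var i) P)" by (simp add: eval_Var)
  then show ?thesis unfolding form_fun_def using Var_forms by blast
qed

text \<open>Linear independence of a family of vectors whose entries are form functions is an open
  condition. Fraction-free elimination keeps the entries form functions, and the pivots multiply
  up to a form that does not vanish at the given point.\<close>

lemma independence_is_open:
  fixes w :: "'b \<Rightarrow> 'r \<Rightarrow> ('v::finite \<Rightarrow> 'a::field) \<Rightarrow> 'a"
  assumes "finite B"
    and "\<And>b u. b \<in> B \<Longrightarrow> w b u \<in> form_fun (d b)"
    and "\<And>c. \<forall>u. (\<Sum>b\<in>B. c b * w b u P0) = 0 \<Longrightarrow> \<forall>b\<in>B. c b = 0"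
  shows "\<exists>e. \<exists>f\<in>form_fun e. f P0 \<noteq> 0 \<and>
    (\<forall>P c. f P \<noteq> 0 \<longrightarrow> (\<forall>u. (\<Sum>b\<in>B. c b * w b u P) = 0) \<longrightarrow> (\<forall>b\<in>B. c b = 0))"
  using assms
proof (induction B arbitrary: w d rule: finite_induct)
  case empty
  show ?case
    by (intro exI[of _ 0] bexI[of _ "\<lambda>_. 1"]) (auto simp: form_fun_const)
next
  case (insert b B)
  obtain v where v: "w b v P0 \<noteq> 0"
  proof (rule ccontr)
    assume "\<not> thesis"
    then have "w b u P0 = 0" for u using that by blast
    then have "(\<Sum>x\<in>insert b B. (if x = b then 1 else 0) * w x u P0) = 0" for u
      by (auto intro!: sum.neutral)
    then have "\<forall>x\<in>insert b B. (if x = b then 1 else 0 :: 'a) = 0"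
      by (intro insert.prems(2)) blast
    then show False by simp
  qed
  \<comment> \<open>One elimination step with the pivot \<open>w b v\<close>: the entry \<open>v\<close> of each \<open>w' x\<close> is zero.\<close>
  define w' where "w' x u P = w b v P * w x u P - w x v P * w b u P" for x u P
  have w': "w' x u \<in> form_fun (d b + d x)" if "x \<in> B" for x u
    unfolding w'_def using that insert.prems(1)
      form_fun_mult[of "w b v" "d b" "w x u" "d x"] form_fun_mult[of "w x v" "d x" "w b u" "d b"]
    by (intro form_fun_diff) (simp_all add: add.commute)
  have sum_w': "(\<Sum>x\<in>B. c x * w' x u P) =
      w b v P * (\<Sum>x\<in>B. c x * w x u P) - (\<Sum>x\<in>B. c x * w x v P) * w b u P" for c u P
    unfolding sum_distrib_left sum_distrib_right sum_subtractf[symmetric]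
    by (intro sum.cong) (simp_all only: w'_def right_diff_distrib mult_ac)
  have ind: "\<forall>x\<in>B. c x = 0" if c: "\<forall>u. (\<Sum>x\<in>B. c x * w' x u P0) = 0" for c
  proof -
    define c' where "c' x = (if x = b then - (\<Sum>y\<in>B. c y * w y v P0) else c x * w b v P0)" for x
    have "(\<Sum>x\<in>insert b B. c' x * w x u P0) = (\<Sum>x\<in>B. c x * w' x u P0)" for u
    proof -
      have "(\<Sum>x\<in>B. c' x * w x u P0) = (\<Sum>x\<in>B. w b v P0 * (c x * w x u P0))"
        using insert.hyps(2) by (intro sum.cong) (auto simp: c'_def)
      then show ?thesis
        using insert.hyps by (simp add: sum_w' c'_def sum_distrib_left)
    qed
    then have "\<forall>x\<in>insert b B. c' x = 0"
      using c by (intro insert.prems(2)) simp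
    then show ?thesis
      using v insert.hyps(2) unfolding c'_def by (metis insertCI mult_eq_0_iff)
  qed
  obtain e f where f: "f \<in> form_fun e" "f P0 \<noteq> 0"
    "\<And>P c. f P \<noteq> 0 \<Longrightarrow> \<forall>u. (\<Sum>x\<in>B. c x * w' x u P) = 0 \<Longrightarrow> \<forall>x\<in>B. c x = 0"
    using insert.IH[of w' "\<lambda>x. d b + d x", OF w' ind] by blast
  have "\<forall>x\<in>insert b B. c x = 0"
    if nz: "f P * w b v P \<noteq> 0" and c: "\<forall>u. (\<Sum>x\<in>insert b B. c x * w x u P) = 0" for P c
  proof -
    have c': "(\<Sum>x\<in>B. c x * w x u P) = - (c b * w b u P)" for u
      using c insert.hyps by (simp add: eq_neg_iff_add_eq_0 add.commute)
    have B: "\<forall>x\<in>B. c x = 0"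
      using nz by (intro f(3)) (auto simp: sum_w' c')
    then have "c b * w b v P = 0" using c'[of v] by simp
    then show ?thesis using nz B by simp
  qed
  then show ?case
    using f(1,2) v insert.prems(1)[of b v]
    by (intro exI[of _ "e + d b"] bexI[of _ "\<lambda>P. f P * w b v P"] form_fun_mult) auto
qed

text \<open>Polynomials with parameters whose coefficients are form functions of degree \<open>d\<close> in the
  parameters.\<close>

definition form_family :: "nat \<Rightarrow> (('v::finite \<Rightarrow> 'a::field) \<Rightarrow> ('v, 'a) mpoly) \<Rightarrow> bool" where
  "form_family d g \<longleftrightarrow> (\<forall>u. (\<lambda>P. Poly_Mapping.lookup (g P) u) \<in> form_fun d)"

lemma finite_splits: "finite {(a, b :: 'v::finite \<Rightarrow>\<^sub>0 nat). a + b = u}"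
proof -
  have "{(a, b). a + b = u} \<subseteq>
      (\<Union>k\<le>wt UNIV u. {a. wt UNIV a = k}) \<times> (\<Union>k\<le>wt UNIV u. {a. wt UNIV a = k})"
    by (auto simp: wt_add)
  then show ?thesis
    by (rule finite_subset) (intro finite_cartesian_product finite_UN_I finite_atMost finite_wt_eq)
qed

lemma lookup_mult_splits:
  fixes p q :: "('v::finite, 'a::field) mpoly"
  shows "Poly_Mapping.lookup (p * q) u =
    (\<Sum>(a, b)\<in>{(a, b). a + b = u}. Poly_Mapping.lookup p a * Poly_Mapping.lookup q b)"
proof -
  have "p * q = (\<Sum>a\<in>Poly_Mapping.keys p. \<Sum>b\<in>Poly_Mapping.keys q.
      Poly_Mapping.single a (Poly_Mapping.lookup p a) * Poly_Mapping.single b (Poly_Mapping.lookup q b))"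
    unfolding sum_product[symmetric] mpoly_expand[symmetric] ..
  then have "Poly_Mapping.lookup (p * q) u = (\<Sum>(a, b)\<in>Poly_Mapping.keys p \<times> Poly_Mapping.keys q.
      if a + b = u then Poly_Mapping.lookup p a * Poly_Mapping.lookup q b else 0)"
    by (simp add: lookup_sum mult_single lookup_single when_def sum.cartesian_product
        case_prod_unfold)
  also have "\<dots> = (\<Sum>(a, b)\<in>{(a, b). a + b = u} \<inter> Poly_Mapping.keys p \<times> Poly_Mapping.keys q.
      Poly_Mapping.lookup p a * Poly_Mapping.lookup q b)"
    by (rule sum.mono_neutral_cong_right) (auto split: if_splits)
  also have "\<dots> = (\<Sum>(a, b)\<in>{(a, b). a + b = u}. Poly_Mapping.lookup p a * Poly_Mapping.lookup q b)"
    by (rule sum.mono_neutral_left) (auto simp: in_keys_iff finite_splits)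
  finally show ?thesis .
qed

lemma form_family_mult:
  "form_family d g \<Longrightarrow> form_family e h \<Longrightarrow> form_family (d + e) (\<lambda>P. g P * h P)"
  unfolding form_family_def lookup_mult_splits case_prod_unfold
  by (intro allI form_fun_sum form_fun_mult) auto

lemma form_family_const: "form_family 0 (\<lambda>P. p)"
  unfolding form_family_def by (simp add: form_fun_const)

lemma form_family_power: "form_family d g \<Longrightarrow> form_family (k * d) (\<lambda>P. g P ^ k)"
  by (induction k) (auto simp: form_family_const form_family_mult)

lemma form_family_prod:
  "finite A \<Longrightarrow> (\<And>x. x \<in> A \<Longrightarrow> form_family (d x) (g x)) \<Longrightarrow>
    form_family (sum d A) (\<lambda>P. \<Prod>x\<in>A. g x P)"
  by (induction A rule: finite_induct) (auto simp: form_family_const form_family_mult)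

lemma form_family_sum:
  "(\<And>x. x \<in> A \<Longrightarrow> form_family d (g x)) \<Longrightarrow> form_family d (\<lambda>P. \<Sum>x\<in>A. g x P)"
  unfolding form_family_def lookup_sum by (auto intro: form_fun_sum)

lemma form_family_scal:
  assumes "h \<in> form_fun d" shows "form_family d (\<lambda>P. scal (h P) p)"
  unfolding form_family_def lookup_scal mult.commute[of "h _"]
  by (intro allI form_fun_const_mult assms)

lemma form_family_add:
  "form_family d g \<Longrightarrow> form_family d h \<Longrightarrow> form_family d (\<lambda>P. g P + h P)"
  unfolding form_family_def lookup_add by (auto intro: form_fun_add)

lemma form_family_chart:
  assumes "p \<in> forms t" shows "form_family t (\<lambda>P. chart i P p)"
  unfolding chart_def hom_ext_def
proof (rule form_family_sum)
  fix u assume "u \<in> Poly_Mapping.keys p"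
  then have deg: "(\<Sum>j\<in>UNIV. Poly_Mapping.lookup u j * 1) = t"
    using assms by (simp add: forms_def)
  have "(\<lambda>P. if j = i then 0 else P j) \<in> form_fun 1" for j
    by (cases "j = i") (use form_fun_zero form_fun_coordinate in auto)
  then have "form_family (\<Sum>j\<in>UNIV. Poly_Mapping.lookup u j * 1)
      (\<lambda>P. \<Prod>j\<in>UNIV. (scal (P i) (Var j) + scal (if j = i then 0 else P j) (Var i)) ^ Poly_Mapping.lookup u j)"
    by (intro form_family_prod form_family_power form_family_add form_family_scal
        form_fun_coordinate finite)
  then show "form_family t (\<lambda>P. Poly_Mapping.single 0 (Poly_Mapping.lookup p u) *
      (\<Prod>j\<in>UNIV. (scal (P i) (Var j) + scal (if j = i then 0 else P j) (Var i)) ^ Poly_Mapping.lookup u j))"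
    unfolding deg using form_family_mult[OF form_family_const] by fastforce
qed

subsection \<open>General points\<close>

text \<open>The basic open set where a form does not vanish.\<close>

lemma general_point_form:
  assumes "f \<in> form_fun e" "f P0 \<noteq> 0" "P0 \<noteq> (\<lambda>_. 0)"
    and "\<And>P. P \<noteq> (\<lambda>_. 0) \<Longrightarrow> f P \<noteq> 0 \<Longrightarrow> Q P"
  shows "general_point Q"
proof -
  obtain p where p: "p \<in> forms e" "f = (\<lambda>P. eval p P)"
    using assms(1) by (auto simp: form_fun_def)
  define U where "U = {P. P \<noteq> (\<lambda>_. 0) \<and> (\<exists>f\<in>{p}. eval f P \<noteq> 0)}"
  have "zariski_open U"
    unfolding zariski_open_def U_def using p(1) by (intro exI[of _ "{p}"]) auto
  moreover have "P0 \<in> U" using assms(2,3) p(2) by (simp add: U_def)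
  moreover have "\<forall>P\<in>U. Q P" using assms(4) p(2) by (simp add: U_def)
  ultimately show ?thesis unfolding general_point_def by blast
qed

lemma general_point_all:
  assumes "\<And>P :: 'v::finite \<Rightarrow> 'a::field. P \<noteq> (\<lambda>_. 0) \<Longrightarrow> Q P"
  shows "general_point Q"
  using assms
  by (intro general_point_form[OF form_fun_const[of 1], of "\<lambda>_. 1"]) (auto simp: fun_eq_iff)

text \<open>Two nonempty open sets meet: on the line through a point of each of them, all but finitely
  many points lie in both.\<close>

lemma zariski_open_meet:
  fixes U V :: "('v::finite \<Rightarrow> 'a::field) set"
  assumes inf: "infinite (UNIV :: 'a set)"
    and U: "zariski_open U" "P \<in> U" and V: "zariski_open V" "Q \<in> V"
  shows "U \<inter> V \<noteq> {}"
proof -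
  obtain S where S: "U = {P. P \<noteq> (\<lambda>_. 0) \<and> (\<exists>f\<in>S. eval f P \<noteq> 0)}"
    using U(1) by (auto simp: zariski_open_def)
  obtain T where T: "V = {P. P \<noteq> (\<lambda>_. 0) \<and> (\<exists>f\<in>T. eval f P \<noteq> 0)}"
    using V(1) by (auto simp: zariski_open_def)
  obtain f where f: "f \<in> S" "eval f P \<noteq> 0" using U(2) S by blast
  obtain g where g: "g \<in> T" "eval g Q \<noteq> 0" using V(2) T by blast
  have "P \<noteq> (\<lambda>_. 0)" using U(2) S by blast
  then obtain i where i: "P i \<noteq> 0" by auto
  define line where "line p = hom_ext (\<lambda>c. [:c:]) (\<lambda>j. [:P j, Q j - P j:]) p" for p :: "('v, 'a) mpoly"
  have "poly (line p) s = eval p (\<lambda>j. P j + s * (Q j - P j))" for p s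
  proof -
    have "ring_map (\<lambda>q :: 'a poly. poly q s)" by (simp add: ring_map_def)
    then show ?thesis
      unfolding line_def eval_eq_hom_ext by (subst ring_map_comp_hom_ext) simp_all
  qed
  note poly_line = this
  have "line f \<noteq> 0" using poly_line[of f 0] f(2) by auto
  moreover have "line (Var i) \<noteq> 0" using poly_line[of "Var i" 0] i by (auto simp: eval_Var)
  moreover have "line g \<noteq> 0" using poly_line[of g 1] g(2) by auto
  ultimately have "line f * line g * line (Var i) \<noteq> 0" by simp
  then have "finite {s. poly (line f * line g * line (Var i)) s = 0}"
    by (rule poly_roots_finite)
  then have "{s. poly (line f * line g * line (Var i)) s = 0} \<noteq> UNIV"
    using inf by metis
  then obtain s where s: "poly (line f * line g * line (Var i)) s \<noteq> 0" by blast
  define R where "R = (\<lambda>j. P j + s * (Q j - P j))"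
  have "eval f R \<noteq> 0" "eval g R \<noteq> 0" "R i \<noteq> 0"
    using s by (auto simp: poly_line R_def eval_Var)
  then have "R \<in> U \<inter> V" using S T f(1) g(1) by (auto simp: fun_eq_iff)
  then show ?thesis by blast
qed

lemma adim_eqI:
  fixes I :: "('v::finite, 'a::field) mpoly set"
  assumes inf: "infinite (UNIV :: 'a set)"
    and gen: "general_point (\<lambda>P. Kdim (degree_part (I \<inter> ideal_pow (point_ideal P) m) t) = d)"
  shows "adim I t m = d"
  unfolding adim_def
proof (rule the_equality, rule gen)
  fix d' assume "general_point (\<lambda>P. Kdim (degree_part (I \<inter> ideal_pow (point_ideal P) m) t) = d')"
  then obtain V where V: "zariski_open V" "V \<noteq> {}"
    "\<And>P. P \<in> V \<Longrightarrow> Kdim (degree_part (I \<inter> ideal_pow (point_ideal P) m) t) = d'"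
    by (auto simp: general_point_def)
  obtain U where U: "zariski_open U" "U \<noteq> {}"
    "\<And>P. P \<in> U \<Longrightarrow> Kdim (degree_part (I \<inter> ideal_pow (point_ideal P) m) t) = d"
    using gen by (auto simp: general_point_def)
  obtain R where "R \<in> U \<inter> V" using zariski_open_meet[OF inf U(1) _ V(1)] U(2) V(2) by blast
  then show "d' = d" using U(3) V(3) by auto
qed

lemma subspace_degree_part: "is_ideal I \<Longrightarrow> K.subspace (degree_part I t)"
  unfolding degree_part_def by (intro K.subspace_inter subspace_ideal subspace_forms)

lemma degree_part_Int: "degree_part (I \<inter> J) t = degree_part I t \<inter> degree_part J t"
  by (auto simp: degree_part_def)

lemma degree_part_subset_forms: "degree_part I t \<subseteq> forms t"
  by (simp add: degree_part_def)

text \<open>The dimension of \<open>[I \<inter> I\<^sub>P\<^sup>m]\<^sub>t\<close> has a general value, namely its minimum over all points.\<close>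

lemma general_dim_exists:
  fixes I :: "('v::finite, 'a::field) mpoly set"
  assumes I: "is_ideal I"
  shows "\<exists>d. general_point (\<lambda>P. Kdim (degree_part (I \<inter> ideal_pow (point_ideal P) m) t) = d)"
proof -
  define N :: "('v \<Rightarrow> 'a) \<Rightarrow> ('v, 'a) mpoly set" where
    "N P = degree_part (I \<inter> ideal_pow (point_ideal P) m) t" for P
  define V where "V = degree_part I t"
  obtain E :: "('v, 'a) mpoly set" where E: "finite E" "forms t \<subseteq> K.span E"
    by (rule finite_spanning_forms)
  have V: "K.subspace V" "V \<subseteq> K.span E"
    unfolding V_def using subspace_degree_part[OF I] degree_part_subset_forms E(2) by blast+
  have N: "K.subspace (N P)" "N P \<subseteq> V" if "P \<noteq> (\<lambda>_. 0)" for P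
    unfolding N_def V_def degree_part_Int
    by (intro K.subspace_inter subspace_degree_part I ideal_ideal_pow_point that) simp
  have "\<exists>P0. P0 \<noteq> (\<lambda>_. 0) \<and> (\<forall>P. P \<noteq> (\<lambda>_. 0) \<longrightarrow> Kdim (N P0) \<le> Kdim (N P))"
    by (rule ex_has_least_nat[of "\<lambda>P. P \<noteq> (\<lambda>_. 0)" "\<lambda>_. 1"]) (auto simp: fun_eq_iff)
  then obtain P0 where P0: "P0 \<noteq> (\<lambda>_. 0)"
    and least: "\<And>P. P \<noteq> (\<lambda>_. 0) \<Longrightarrow> Kdim (N P0) \<le> Kdim (N P)"
    by blast
  obtain i where i: "P0 i \<noteq> 0" using P0 by auto
  obtain C where C: "finite C" "K.independent C" "C \<subseteq> V" "card C + Kdim (N P0) = Kdim V"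
    "K.span C \<inter> N P0 = {0}"
    by (rule K.complement_basis[OF V E(1) N[OF P0]])
  \<comment> \<open>The entries of \<open>w F\<close> are the coefficients of \<open>F\<close>, in coordinates centred at \<open>P\<close>, that have to
    vanish for \<open>F\<close> to have multiplicity \<open>m\<close> at \<open>P\<close>.\<close>
  define w where "w F u P = (if wt (- {i}) u < m then Poly_Mapping.lookup (chart i P F) u else 0)"
    for F :: "('v, 'a) mpoly" and u P
  define comb where "comb c = (\<Sum>F\<in>C. scal (c F) F)" for c
  have comb_span: "comb c \<in> K.span C" for c
    unfolding comb_def by (intro K.span_sum K.span_scale K.span_base)
  have comb_V: "comb c \<in> V" for c
    unfolding comb_def using C(3) V(1) by (intro K.subspace_sum K.subspace_scale) auto
  have "Poly_Mapping.lookup (chart i P (comb c)) u = (\<Sum>F\<in>C. c F * Poly_Mapping.lookup (chart i P F) u)"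
    for c P u
    by (simp add: comb_def ring_map_sum[OF ring_map_chart] lookup_sum chart_scal lookup_scal)
  then have "(\<Sum>F\<in>C. c F * w F u P) =
      (if wt (- {i}) u < m then Poly_Mapping.lookup (chart i P (comb c)) u else 0)" for c P u
    by (simp add: w_def)
  then have "(\<forall>u. (\<Sum>F\<in>C. c F * w F u P) = 0) \<longleftrightarrow> chart i P (comb c) \<in> vanishing (- {i}) m" for c P
    by (simp add: vanishing_iff)
  then have comb_N: "(\<forall>u. (\<Sum>F\<in>C. c F * w F u P) = 0) \<longleftrightarrow> comb c \<in> N P" if "P i \<noteq> 0" for c P
    using comb_V[of c] ideal_pow_point_ideal_eq[of P i m, OF that]
    by (auto simp: N_def V_def degree_part_def)
  have "\<forall>F\<in>C. c F = 0" if "comb c = 0" for c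
    using K.independentD[OF C(2,1) subset_refl] that unfolding comb_def by blast
  note comb_0 = this
  have wforms: "w F u \<in> form_fun t" if "F \<in> C" for F u
  proof -
    have "F \<in> forms t" using that C(3) degree_part_subset_forms unfolding V_def by blast
    then have "(\<lambda>P. Poly_Mapping.lookup (chart i P F) u) \<in> form_fun t"
      using form_family_chart unfolding form_family_def by blast
    then show ?thesis
      unfolding w_def by (cases "wt (- {i}) u < m") (simp_all add: form_fun_zero)
  qed
  have ind: "\<forall>F\<in>C. c F = 0" if "\<forall>u. (\<Sum>F\<in>C. c F * w F u P0) = 0" for c
    using that comb_N[of P0, OF i] comb_span C(5) comb_0 by blast
  obtain e f where f: "f \<in> form_fun e" "f P0 \<noteq> 0"
    "\<And>P c. f P \<noteq> 0 \<Longrightarrow> \<forall>u. (\<Sum>F\<in>C. c F * w F u P) = 0 \<Longrightarrow> \<forall>F\<in>C. c F = 0"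
    using independence_is_open[of C w "\<lambda>_. t", OF C(1) wforms ind] by blast
  have "Kdim (N P) = Kdim (N P0)" if P: "P \<noteq> (\<lambda>_. 0)" and nz: "f P * P i \<noteq> 0" for P
  proof -
    have "K.span C \<inter> N P \<subseteq> {0}"
    proof
      fix G assume G: "G \<in> K.span C \<inter> N P"
      then obtain c where c: "G = comb c"
        unfolding K.span_finite[OF C(1)] comb_def by blast
      then have "\<forall>F\<in>C. c F = 0"
        using f(3)[of P c] comb_N[of P c] G nz by auto
      then show "G \<in> {0}" by (simp add: c comb_def)
    qed
    then have "K.span C \<inter> N P = {0}"
      using K.span_zero K.subspace_0[OF N(1)[OF P]] by blast
    then have "card C + Kdim (N P) \<le> Kdim V"
      by (rule K.dim_le_of_trivial_Int[OF V E(1) N[OF P] C(2,3)])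
    then show ?thesis using C(4) least[OF P] by linarith
  qed
  then have "general_point (\<lambda>P. Kdim (N P) = Kdim (N P0))"
    \<comment> \<open>The coordinate \<open>P i\<close> is included as a factor because \<open>chart i P\<close> needs it to be nonzero.\<close>
    using f(2) i by (intro general_point_form[OF form_fun_mult[OF f(1) form_fun_coordinate[of i]] _ P0]) auto
  then show ?thesis unfolding N_def by blast
qed

section \<open>Virtual dimension and unexpected hypersurfaces\<close>

text \<open>The dimension at \<open>P\<close> is the virtual one exactly when \<open>[I]\<^sub>t\<close> maps onto the quotient of
  \<open>[R]\<^sub>t\<close> by \<open>[I\<^sub>P\<^sup>m]\<^sub>t\<close>.\<close>

lemma dim_eq_vdim_iff:
  fixes I :: "('v::finite, 'a::field) mpoly set"
  assumes I: "is_ideal I" and P: "P \<noteq> (\<lambda>_. 0)" and "1 \<le> m" "m \<le> t"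
  shows "int (Kdim (degree_part (I \<inter> ideal_pow (point_ideal P) m) t)) = vdim I t m \<longleftrightarrow>
    {x + y | x y. x \<in> degree_part I t \<and> y \<in> degree_part (ideal_pow (point_ideal P) m) t} = forms t"
    (is "int ?N = _ \<longleftrightarrow> ?S = _")
proof -
  let ?J = "degree_part (ideal_pow (point_ideal P) m) t"
  obtain E :: "('v, 'a) mpoly set" where E: "finite E" "forms t \<subseteq> K.span E"
    by (rule finite_spanning_forms)
  have J: "K.subspace ?J" using subspace_degree_part ideal_ideal_pow_point P by blast
  have sub: "degree_part I t \<subseteq> K.span E" "?J \<subseteq> K.span E"
    using degree_part_subset_forms E(2) by blast+
  have "Kdim ?S + ?N = Kdim (degree_part I t) + Kdim ?J"
    using K.dim_sum_add_dim_Int[OF subspace_degree_part[OF I] sub(1) J sub(2) E(1)]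
    unfolding degree_part_Int .
  moreover have "Kdim ?J + ((m + (CARD('v) - 1) - 1) choose (CARD('v) - 1)) = Kdim (forms t :: ('v, 'a) mpoly set)"
    by (rule codim_ideal_pow_point[OF P assms(3,4)])
  ultimately have "int ?N = vdim I t m \<longleftrightarrow> Kdim ?S = Kdim (forms t :: ('v, 'a) mpoly set)"
    by (simp add: vdim_def Let_def) linarith
  also have "\<dots> \<longleftrightarrow> ?S = forms t"
  proof
    assume dim: "Kdim ?S = Kdim (forms t :: ('v, 'a) mpoly set)"
    have "?S \<subseteq> forms t"
      using degree_part_subset_forms K.subspace_add[OF subspace_forms] by blast
    then show "?S = forms t"
      using K.subspace_eq_of_dim[OF subspace_forms E(2,1) K.subspace_sums[OF subspace_degree_part[OF I] J]] dim
      by simp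
  qed simp
  finally show ?thesis .
qed

text \<open>Homogeneity makes the set in the definition of \<open>alpha\<close> nonempty; an element of degree \<open>0\<close>
  would be a unit.\<close>

lemma alpha_pos:
  fixes I :: "('v::finite, 'a::field) mpoly set"
  assumes "is_ideal I" "homogeneous_ideal I" "I \<noteq> UNIV" "I \<noteq> {0}"
  shows "1 \<le> alpha I"
proof -
  obtain S where S: "S \<subseteq> (\<Union>t. forms t)" "I = ideal_gen S"
    using assms(2) by (auto simp: homogeneous_ideal_def)
  have "\<not> S \<subseteq> {0}"
    using S(2) assms(4) ideals.span_minimal[OF _ ideals.subspace_single_0] ideals.span_zero by blast
  then obtain f t where "f \<in> S" "f \<noteq> 0" "f \<in> forms t" using S(1) by blast
  then have "degree_part I t \<noteq> {0}"
    unfolding degree_part_def S(2) using ideals.span_base by blast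
  then have "degree_part I (alpha I) \<noteq> {0}"
    unfolding alpha_def by (rule LeastI)
  then obtain g where g: "g \<in> degree_part I (alpha I)" "g \<noteq> 0"
    using K.subspace_0[OF subspace_degree_part[OF assms(1)]] by blast
  have "alpha I \<noteq> 0"
  proof
    assume "alpha I = 0"
    then have "u = 0" if "u \<in> Poly_Mapping.keys g" for u
      using g(1) that by (auto simp: degree_part_def forms_def intro!: poly_mapping_eqI)
    then have eq: "g = Poly_Mapping.single 0 (Poly_Mapping.lookup g 0)"
      by (intro poly_mapping_eqI) (auto simp: lookup_single when_def in_keys_iff)
    then have "Poly_Mapping.lookup g 0 \<noteq> 0" using g(2) by auto
    then have "Poly_Mapping.single 0 (1 / Poly_Mapping.lookup g 0) * g = 1"
      by (subst eq) (simp add: mult_single)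
    then have "1 \<in> I"
      using ideal_mult_left[OF assms(1)] g(1) unfolding degree_part_def by (metis IntD1)
    then have "p \<in> I" for p using ideal_mult_left[OF assms(1), of 1 p] by simp
    then show False using assms(3) by blast
  qed
  then show ?thesis by simp
qed

theorem proposition3p8:
  fixes I\<^sub>X :: "('v::finite, 'a::field) mpoly set"
  assumes "infinite (UNIV :: 'a set)"
    and "subscheme_ideal I\<^sub>X"
    and "I\<^sub>X \<noteq> UNIV"
    and "I\<^sub>X \<noteq> {0}"
    and "AV I\<^sub>X 0 (alpha I\<^sub>X) = 0"
  shows "\<forall>t\<ge>1. \<forall>m\<ge>1. \<not> admits_unexpected I\<^sub>X t m"
proof (intro allI impI)
  fix t m :: nat
  assume m: "1 \<le> m"
  have I: "is_ideal I\<^sub>X" "homogeneous_ideal I\<^sub>X"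
    using assms(2) by (auto simp: subscheme_ideal_def)
  define a where "a = alpha I\<^sub>X"
  have a: "1 \<le> a" unfolding a_def by (rule alpha_pos[OF I assms(3,4)])
  let ?N = "\<lambda>P t m. Kdim (degree_part (I\<^sub>X \<inter> ideal_pow (point_ideal P) m) t)"
  show "\<not> admits_unexpected I\<^sub>X t m"
  proof (cases "a \<le> t \<and> m \<le> t")
    case True
    obtain d where d: "general_point (\<lambda>P. ?N P a a = d)"
      using general_dim_exists[OF I(1)] by blast
    have "int d = vdim I\<^sub>X a a"
      using assms(5) adim_eqI[OF assms(1) d] by (simp add: AV_def a_def)
    moreover obtain U where U: "zariski_open U" "U \<noteq> {}" "\<And>P. P \<in> U \<Longrightarrow> ?N P a a = d"
      using d by (auto simp: general_point_def)
    ultimately have "int (?N P t m) = vdim I\<^sub>X t m" if "P \<in> U" for P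
    proof -
      have P: "P \<noteq> (\<lambda>_. 0)" using U(1) that by (auto simp: zariski_open_def)
      have "int (?N P a a) = vdim I\<^sub>X a a" using U(3)[OF that] \<open>int d = vdim I\<^sub>X a a\<close> by simp
      then have "{x + y | x y. x \<in> degree_part I\<^sub>X a \<and> y \<in> degree_part (ideal_pow (point_ideal P) a) a} = forms a"
        using dim_eq_vdim_iff[OF I(1) P a order_refl] by blast
      then have "{x + y | x y. x \<in> degree_part I\<^sub>X t \<and> y \<in> degree_part (ideal_pow (point_ideal P) m) t} = forms t"
        using sum_point_ideal_propagates[OF I(1) P a] True by blast
      then show ?thesis using dim_eq_vdim_iff[OF I(1) P m] True by blast
    qed
    then have "general_point (\<lambda>P. ?N P t m = nat (vdim I\<^sub>X t m))"
      unfolding general_point_def using U(1,2) by (metis nat_int)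
    \<comment> \<open>On \<open>U\<close> the virtual dimension equals a dimension, so it is nonnegative and \<open>nat\<close> loses nothing.\<close>
    then have "adim I\<^sub>X t m = nat (vdim I\<^sub>X t m)" by (rule adim_eqI[OF assms(1)])
    then show ?thesis by (simp add: admits_unexpected_def edim_def)
  next
    case False
    have "?N P t m = 0" if P: "P \<noteq> (\<lambda>_. 0)" for P
    proof -
      have "degree_part I\<^sub>X t = {0} \<or> degree_part (ideal_pow (point_ideal P) m) t = {0}"
        using False not_less_Least[of t "\<lambda>t. degree_part I\<^sub>X t \<noteq> {0}"]
          degree_part_ideal_pow_point_trivial[OF P, of t m]
        by (auto simp: a_def alpha_def not_le)
      moreover have "0 \<in> degree_part I\<^sub>X t" "0 \<in> degree_part (ideal_pow (point_ideal P) m) t"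
        using K.subspace_0 subspace_degree_part I(1) ideal_ideal_pow_point[OF P] by blast+
      ultimately have "degree_part (I\<^sub>X \<inter> ideal_pow (point_ideal P) m) t = {0}"
        unfolding degree_part_Int by blast
      then show ?thesis
        using K.dim_span_eq_card_independent[OF K.independent_empty] by simp
    qed
    then have "adim I\<^sub>X t m = 0"
      by (intro adim_eqI[OF assms(1)] general_point_all)
    then show ?thesis by (simp add: admits_unexpected_def edim_def)
  qed
qed

end
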